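(* Every eigenvalue of $\mathcal{P}^{-1}\mathcal{A}$ belongs to $\displaystyle\bigcup_{k=0}^{N}\mathcal{I}_{k+1}$.
   Context: Let $N\ge 1$ and let $n_0\ge n_1\ge\dots\ge n_N\ge 1$ be integers. Let $A_0\in\mathbb{R}^{n_0\times n_0}$ be symmetric positive definite, let $A_k\in\mathbb{R}^{n_k\times n_k}$ be symmetric positive semidefinite for $k=1,\dots,N$, and let $B_k\in\mathbb{R}^{n_k\times n_{k-1}}$ have full rank for $k=1,\dots,N$. Let $\mathcal{A}$ be the symmetric block tridiagonal matrix with diagonal blocks $A_0,-A_1,A_2,\dots,(-1)^NA_N$, with block subdiagonal $B_1,\dots,B_N$ and block superdiagonal $B_1^T,\dots,B_N^T$. Let $\widehat S_k\in\mathbb{R}^{n_k\times n_k}$, $k=0,\dots,N$, be symmetric positive definite matrices (regarded as approximations of $A_0$ for $k=0$ and of $\tilde S_k=A_k+B_k\widehat S_{k-1}^{-1}B_k^T$ for $k\ge1$), and let $\mathcal{P}=\mathrm{blkdiag}(\widehat S_0,\dots,\widehat S_N)$. Put $E_k=\widehat S_k^{-1/2}A_k\widehat S_k^{-1/2}$ for $k=0,\dots,N$ and $R_k=\widehat S_k^{-1/2}B_k\widehat S_{k-1}^{-1/2}$ for $k=1,\dots,N$. Let $\alpha_E^{(k)},\beta_E^{(k)}$ be the smallest and largest eigenvalues of $E_k$ ($0\le k\le N$), and $\alpha_R^{(k)},\beta_R^{(k)}$ the smallest and largest eigenvalues of $R_kR_k^T$ ($1\le k\le N$). A parameter choice $\boldsymbol\gamma_E=(\gamma_E^{(0)},\dots,\gamma_E^{(N)})$,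 $\boldsymbol\gamma_R=(\gamma_R^{(1)},\dots,\gamma_R^{(N)})$ is called admissible if $\gamma_E^{(k)}\in[\alpha_E^{(k)},\beta_E^{(k)}]$ and $\gamma_R^{(k)}\in[\alpha_R^{(k)},\beta_R^{(k)}]$ for all $k$. For given parameters define polynomials in $\lambda$ by $U_0=1$, $U_1(\lambda)=\lambda-\gamma_E^{(0)}$ and $U_{k+1}(\lambda)=(\lambda+(-1)^{k+1}\gamma_E^{(k)})U_k(\lambda)-\gamma_R^{(k)}U_{k-1}(\lambda)$ for $1\le k\le N$. For $1\le k\le N+1$ let $Z_k\subset\mathbb{R}$ be the set of all real roots of $U_k$ as the parameters range over all admissible choices ($0\notin Z_k$). Then $\mathcal{I}_k$ is the union of the smallest closed interval containing $Z_k\cap(-\infty,0)$ and the smallest closed interval containing $Z_k\cap(0,\infty)$ (an interval being empty if the corresponding set is empty). *)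

theory Defs
  imports
    "Jordan_Normal_Form.Spectral_Radius"
    "Jordan_Normal_Form.Gauss_Jordan_Elimination"
    "Jordan_Normal_Form.DL_Rank"
begin

definition sym_pos_semidef :: "nat \<Rightarrow> real mat \<Rightarrow> bool" where
  "sym_pos_semidef m X \<longleftrightarrow> X \<in> carrier_mat m m \<and> transpose_mat X = X \<and>
     (\<forall>v \<in> carrier_vec m. v \<bullet> (X *\<^sub>v v) \<ge> 0)"

definition sym_pos_def :: "nat \<Rightarrow> real mat \<Rightarrow> bool" where
  "sym_pos_def m X \<longleftrightarrow> X \<in> carrier_mat m m \<and> transpose_mat X = X \<and>
     (\<forall>v \<in> carrier_vec m. v \<noteq> 0\<^sub>v m \<longrightarrow> v \<bullet> (X *\<^sub>v v) > 0)"

definition full_rank :: "real mat \<Rightarrow> bool" where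
  "full_rank X \<longleftrightarrow> vec_space.rank (dim_row X) X = min (dim_row X) (dim_col X)"

text \<open>Unspecified for singular matrices.\<close>

definition mat_inv :: "real mat \<Rightarrow> real mat" where
  "mat_inv X = the (mat_inverse X)"

text \<open>The principal square root; meaningful for symmetric positive semidefinite matrices.\<close>

definition mat_sqrt :: "real mat \<Rightarrow> real mat" where
  "mat_sqrt X = (THE Y. sym_pos_semidef (dim_row X) Y \<and> Y * Y = X)"

definition inv_sqrt :: "real mat \<Rightarrow> real mat" where
  "inv_sqrt X = mat_inv (mat_sqrt X)"

text \<open>Assembling a square matrix from blocks \<open>F k l\<close> of size \<open>n k\<close> by \<open>n l\<close>, for
  \<open>k, l = 0, \<dots>, N\<close>: the block with number \<open>k\<close> occupies the indices from \<open>block_start n k\<close> up to,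
  but excluding, \<open>block_start n (Suc k)\<close>, and \<open>block_no n i\<close> is the number of the block that
  contains the index \<open>i\<close>.\<close>

definition block_start :: "(nat \<Rightarrow> nat) \<Rightarrow> nat \<Rightarrow> nat" where
  "block_start n k = (\<Sum>j<k. n j)"

definition block_no :: "(nat \<Rightarrow> nat) \<Rightarrow> nat \<Rightarrow> nat" where
  "block_no n i = (LEAST k. i < block_start n (Suc k))"

definition block_mat :: "nat \<Rightarrow> (nat \<Rightarrow> nat) \<Rightarrow> (nat \<Rightarrow> nat \<Rightarrow> real mat) \<Rightarrow> real mat" where
  "block_mat N n F = mat (block_start n (Suc N)) (block_start n (Suc N))
     (\<lambda>(i, j). F (block_no n i) (block_no n j) $$
        (i - block_start n (block_no n i), j - block_start n (block_no n j)))"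

definition tridiag_mat ::
  "nat \<Rightarrow> (nat \<Rightarrow> nat) \<Rightarrow> (nat \<Rightarrow> real mat) \<Rightarrow> (nat \<Rightarrow> real mat) \<Rightarrow> real mat" where
  "tridiag_mat N n A B = block_mat N n (\<lambda>k l.
     if k = l then (-1) ^ k \<cdot>\<^sub>m A k
     else if k = Suc l then B k
     else if l = Suc k then transpose_mat (B l)
     else 0\<^sub>m (n k) (n l))"

definition precond_mat :: "nat \<Rightarrow> (nat \<Rightarrow> real mat) \<Rightarrow> real mat" where
  "precond_mat N S = diag_block_mat (map S [0..<Suc N])"

definition E_mat :: "(nat \<Rightarrow> real mat) \<Rightarrow> (nat \<Rightarrow> real mat) \<Rightarrow> nat \<Rightarrow> real mat" where
  "E_mat A S k = inv_sqrt (S k) * A k * inv_sqrt (S k)"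

definition R_mat :: "(nat \<Rightarrow> real mat) \<Rightarrow> (nat \<Rightarrow> real mat) \<Rightarrow> nat \<Rightarrow> real mat" where
  "R_mat B S k = inv_sqrt (S k) * B k * inv_sqrt (S (k - 1))"

definition admissible ::
  "nat \<Rightarrow> (nat \<Rightarrow> real mat) \<Rightarrow> (nat \<Rightarrow> real mat) \<Rightarrow> (nat \<Rightarrow> real mat) \<Rightarrow>
   (nat \<Rightarrow> real) \<Rightarrow> (nat \<Rightarrow> real) \<Rightarrow> bool" where
  "admissible N A B S \<gamma>E \<gamma>R \<longleftrightarrow>
     (\<forall>k\<in>{0..N}. \<gamma>E k \<in> {Min (spectrum (E_mat A S k)) .. Max (spectrum (E_mat A S k))}) \<and>
     (\<forall>k\<in>{1..N}. \<gamma>R k \<in>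
        {Min (spectrum (R_mat B S k * transpose_mat (R_mat B S k))) ..
         Max (spectrum (R_mat B S k * transpose_mat (R_mat B S k)))})"

fun U_poly :: "(nat \<Rightarrow> real) \<Rightarrow> (nat \<Rightarrow> real) \<Rightarrow> nat \<Rightarrow> real poly" where
  "U_poly \<gamma>E \<gamma>R 0 = 1"
| "U_poly \<gamma>E \<gamma>R (Suc 0) = [:- \<gamma>E 0, 1:]"
| "U_poly \<gamma>E \<gamma>R (Suc (Suc k)) =
     [:(-1) ^ Suc (Suc k) * \<gamma>E (Suc k), 1:] * U_poly \<gamma>E \<gamma>R (Suc k)
     - Polynomial.smult (\<gamma>R (Suc k)) (U_poly \<gamma>E \<gamma>R k)"

definition root_set ::
  "nat \<Rightarrow> (nat \<Rightarrow> real mat) \<Rightarrow> (nat \<Rightarrow> real mat) \<Rightarrow> (nat \<Rightarrow> real mat) \<Rightarrow> nat \<Rightarrow> real set" where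
  "root_set N A B S k =
     {x. \<exists>\<gamma>E \<gamma>R. admissible N A B S \<gamma>E \<gamma>R \<and> poly (U_poly \<gamma>E \<gamma>R k) x = 0}"

text \<open>The smallest closed interval containing a bounded set. The intervals include
  \<open>{a..b}\<close> with \<open>a > b\<close>, so the empty set is mapped to itself.\<close>

definition interval_hull :: "real set \<Rightarrow> real set" where
  "interval_hull X = \<Inter> {{a..b} | a b. X \<subseteq> {a..b}}"

definition I_set ::
  "nat \<Rightarrow> (nat \<Rightarrow> real mat) \<Rightarrow> (nat \<Rightarrow> real mat) \<Rightarrow> (nat \<Rightarrow> real mat) \<Rightarrow> nat \<Rightarrow> real set" where
  "I_set N A B S k =
     interval_hull (root_set N A B S k \<inter> {..<0}) \<union> interval_hull (root_set N A B S k \<inter> {0<..})"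

end

theory Submission
  imports Defs "HOL-Analysis.Elementary_Topology"
begin

text \<open>
  Let \<open>w\<close> be an eigenvector for \<open>t\<close>, with blocks \<open>w\<^sub>k\<close>. Since the preconditioner is positive
  definite and the block tridiagonal matrix is symmetric, \<open>t\<close> and \<open>w\<close> can be taken real
  (\<open>real_generalized_eigenvector_exists\<close>), and the scaled blocks \<open>x\<^sub>k\<close>, obtained by applying the
  square root of \<open>S k\<close> to \<open>w\<^sub>k\<close>, satisfy the three-term recurrence
  \<open>t x\<^sub>k = (-1)\<^sup>k E\<^sub>k x\<^sub>k + R\<^sub>k x\<^sub>k\<^sub>-\<^sub>1 + R\<^sub>k\<^sub>+\<^sub>1\<^sup>T x\<^sub>k\<^sub>+\<^sub>1\<close> (\<open>block_recurrence_exists\<close>).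

  Eliminate the blocks from the top. With the pivots
  \<open>Z\<^sub>0 = t - E\<^sub>0\<close> and \<open>Z\<^sub>k = t - (-1)\<^sup>k E\<^sub>k - R\<^sub>k Z\<^sub>k\<^sub>-\<^sub>1\<^sup>-\<^sup>1 R\<^sub>k\<^sup>T\<close> the recurrence becomes
  \<open>Z\<^sub>k x\<^sub>k = R\<^sub>k\<^sub>+\<^sub>1\<^sup>T x\<^sub>k\<^sub>+\<^sub>1\<close>, and \<open>Z\<^sub>N x\<^sub>N = 0\<close> for the last block. The pivots obey the same
  recursion as the ratios \<open>U\<^sub>k\<^sub>+\<^sub>1(t) / U\<^sub>k(t)\<close>, with matrices in place of numbers, and the decisive
  point is that every Rayleigh quotient of \<open>Z\<^sub>k\<close> is the value of \<open>U\<^sub>k\<^sub>+\<^sub>1(t) / U\<^sub>k(t)\<close> for some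
  admissible parameters (\<open>block_elimination\<close>): for a vector \<open>v\<close>, take as parameters the Rayleigh
  quotients of \<open>E\<^sub>k\<close> and \<open>R\<^sub>k R\<^sub>k\<^sup>T\<close> at \<open>v\<close>; the form of the inverse of \<open>Z\<^sub>k\<^sub>-\<^sub>1\<close> at
  \<open>y = R\<^sub>k\<^sup>T v\<close> is \<open>(y \<bullet> y) / z\<close> with \<open>z\<close> in the range already covered by the ratios one level
  below (\<open>inverse_form_ratio\<close>).

  If \<open>t\<close> is a root of no \<open>U\<^sub>k\<^sub>+\<^sub>1\<close> with \<open>k \<le> N\<close> and admissible parameters, the ratios never vanish. As
  the parameters range over a product of intervals, the ratios fill an interval
  (\<open>ratio_range_interval\<close>), which therefore lies on one side of \<open>0\<close>. So every pivot is
  definite, hence \<open>x\<^sub>N = 0\<close>, and going back \<open>x\<^sub>k = 0\<close> for all \<open>k\<close>, which is absurd. Thus \<open>t\<close> is a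
  root of some \<open>U\<^sub>k\<^sub>+\<^sub>1\<close> (\<open>eigenvalue_is_root\<close>). Finally \<open>0\<close> is never such a root: consecutive
  values \<open>U\<^sub>k(0)\<close>, \<open>U\<^sub>k\<^sub>+\<^sub>1(0)\<close> have a product of known sign (\<open>U_poly_at_0\<close>), because positive
  definiteness of \<open>A 0\<close> and full rank of the \<open>B k\<close> make \<open>\<gamma>E 0\<close> and all \<open>\<gamma>R k\<close> positive, while
  semidefiniteness of the \<open>A k\<close> makes the other parameters nonnegative. Therefore the roots, split by
  sign, are contained in the hulls.

  The linear algebra behind this is the theory of Rayleigh quotients of real symmetric matrices
  (\<open>least_eigenvalue_exists\<close>, \<open>spectrum_sym_bounds\<close>) and the existence and uniqueness of the square
  root of a positive definite matrix (\<open>sqrt_exists\<close>, \<open>sqrt_unique\<close>).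
\<close>

section \<open>Symmetric matrices and their quadratic forms\<close>

definition sym_mat :: "nat \<Rightarrow> real mat \<Rightarrow> bool" where
  "sym_mat n X \<longleftrightarrow> X \<in> carrier_mat n n \<and> transpose_mat X = X"

lemma sym_matD: "sym_mat n X \<Longrightarrow> X \<in> carrier_mat n n" "sym_mat n X \<Longrightarrow> transpose_mat X = X"
  by (auto simp: sym_mat_def)

lemma sym_pos_semidef_iff:
  "sym_pos_semidef n X \<longleftrightarrow> sym_mat n X \<and> (\<forall>v \<in> carrier_vec n. 0 \<le> v \<bullet> (X *\<^sub>v v))"
  by (auto simp: sym_pos_semidef_def sym_mat_def)

lemma sym_pos_def_iff:
  "sym_pos_def n X \<longleftrightarrow>
     sym_mat n X \<and> (\<forall>v \<in> carrier_vec n. v \<noteq> 0\<^sub>v n \<longrightarrow> 0 < v \<bullet> (X *\<^sub>v v))"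
  by (auto simp: sym_pos_def_def sym_mat_def)

lemma sym_form_swap:
  assumes X: "sym_mat n X" and x: "x \<in> carrier_vec n" and y: "y \<in> carrier_vec n"
  shows "x \<bullet> (X *\<^sub>v y) = y \<bullet> (X *\<^sub>v x)"
proof -
  have "x \<bullet> (X *\<^sub>v y) = (transpose_mat X *\<^sub>v x) \<bullet> y"
    using transpose_vec_mult_scalar[OF sym_matD(1)[OF X] y x] by simp
  also have "\<dots> = y \<bullet> (X *\<^sub>v x)"
    using comm_scalar_prod[of "X *\<^sub>v x" n y] sym_matD[OF X] x y by auto
  finally show ?thesis .
qed

lemma sym_pos_def_imp_semidef:
  assumes "sym_pos_def n X"
  shows "sym_pos_semidef n X"
  unfolding sym_pos_semidef_iff
proof (intro conjI ballI)
  fix v :: "real vec" assume v: "v \<in> carrier_vec n"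
  show "0 \<le> v \<bullet> (X *\<^sub>v v)"
  proof (cases "v = 0\<^sub>v n")
    case True
    then show ?thesis
      using assms by (auto simp: sym_pos_def_def intro: mult_mat_vec_carrier)
  qed (use assms v in \<open>auto simp: sym_pos_def_iff less_imp_le\<close>)
qed (use assms in \<open>auto simp: sym_pos_def_iff\<close>)

lemma real_scalar_prod_self_nonneg: "0 \<le> (v :: real vec) \<bullet> v"
  by (simp add: scalar_prod_def sum_nonneg)

lemma real_scalar_prod_self_eq_0_iff:
  "(v :: real vec) \<in> carrier_vec n \<Longrightarrow> v \<bullet> v = 0 \<longleftrightarrow> v = 0\<^sub>v n"
  by (auto simp: scalar_prod_def sum_nonneg_eq_0_iff vec_eq_iff)

lemma real_scalar_prod_self_pos:
  "(v :: real vec) \<in> carrier_vec n \<Longrightarrow> v \<noteq> 0\<^sub>v n \<Longrightarrow> 0 < v \<bullet> v"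
  using real_scalar_prod_self_nonneg[of v] real_scalar_prod_self_eq_0_iff[of v n] by auto

lemma smult_mat_mult_vec:
  assumes "(X :: real mat) \<in> carrier_mat m n" "v \<in> carrier_vec n"
  shows "(k \<cdot>\<^sub>m X) *\<^sub>v v = k \<cdot>\<^sub>v (X *\<^sub>v v)"
  using assms by (intro eq_vecI) auto

text \<open>
  Since \<open>2 \<bar>v\<^sub>i v\<^sub>j\<bar> \<le> v\<^sub>i\<^sup>2 + v\<^sub>j\<^sup>2\<close>, the sum of the absolute values of the entries bounds the form; adding
  \<open>1\<close> makes the bound positive, so that one can divide by it.
\<close>

lemma form_bounded:
  assumes X: "(X :: real mat) \<in> carrier_mat n n"
  obtains K where "0 < K" "\<And>v. v \<in> carrier_vec n \<Longrightarrow> \<bar>v \<bullet> (X *\<^sub>v v)\<bar> \<le> K * (v \<bullet> v)"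
proof -
  define K where "K = (\<Sum>i<n. \<Sum>j<n. \<bar>X $$ (i, j)\<bar>)"
  have "\<bar>v \<bullet> (X *\<^sub>v v)\<bar> \<le> (K + 1) * (v \<bullet> v)" if v: "v \<in> carrier_vec n" for v
  proof -
    have sq: "(v $ i)\<^sup>2 \<le> v \<bullet> v" if "i < n" for i
      using member_le_sum[of i "{0..<n}" "\<lambda>i. (v $ i)\<^sup>2"] that v
      by (auto simp: scalar_prod_def power2_eq_square)
    have entry: "\<bar>v $ i * v $ j\<bar> \<le> v \<bullet> v" if "i < n" "j < n" for i j
    proof -
      have "2 * \<bar>v $ i * v $ j\<bar> \<le> (v $ i)\<^sup>2 + (v $ j)\<^sup>2"
        using sum_squares_bound[of "\<bar>v $ i\<bar>" "\<bar>v $ j\<bar>"] by (simp add: abs_mult)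
      then show ?thesis using sq[OF that(1)] sq[OF that(2)] by linarith
    qed
    have "v \<bullet> (X *\<^sub>v v) = (\<Sum>i<n. \<Sum>j<n. X $$ (i, j) * (v $ i * v $ j))"
      using X v by (simp add: scalar_prod_def sum_distrib_left atLeast0LessThan mult_ac)
    also have "\<bar>\<dots>\<bar> \<le> (\<Sum>i<n. \<Sum>j<n. \<bar>X $$ (i, j) * (v $ i * v $ j)\<bar>)"
      by (intro order_trans[OF sum_abs] sum_mono sum_abs)
    also have "\<dots> \<le> (\<Sum>i<n. \<Sum>j<n. \<bar>X $$ (i, j)\<bar> * (v \<bullet> v))"
      by (intro sum_mono) (auto simp: abs_mult[of "X $$ _"] intro!: mult_left_mono entry)
    also have "\<dots> = K * (v \<bullet> v)"
      by (simp add: K_def sum_distrib_right)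
    finally show ?thesis
      using real_scalar_prod_self_nonneg[of v] by (simp add: algebra_simps)
  qed
  moreover have "0 < K + 1"
    by (simp add: K_def add_nonneg_pos sum_nonneg)
  ultimately show ?thesis using that by blast
qed

lemma form_minus_smult:
  assumes X: "sym_mat n X" and x: "x \<in> carrier_vec n" and y: "y \<in> carrier_vec n"
  shows "(x - t \<cdot>\<^sub>v y) \<bullet> (X *\<^sub>v (x - t \<cdot>\<^sub>v y)) =
    x \<bullet> (X *\<^sub>v x) - 2 * t * (x \<bullet> (X *\<^sub>v y)) + t\<^sup>2 * (y \<bullet> (X *\<^sub>v y))"
proof -
  have Xc: "X \<in> carrier_mat n n" using sym_matD[OF X] by simp
  have [simp]: "X *\<^sub>v x \<in> carrier_vec n" "X *\<^sub>v y \<in> carrier_vec n" using Xc x y by auto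
  have "X *\<^sub>v (x - t \<cdot>\<^sub>v y) = X *\<^sub>v x - t \<cdot>\<^sub>v (X *\<^sub>v y)"
    using Xc x y by (simp add: mult_minus_distrib_mat_vec[OF Xc] mult_mat_vec[OF Xc])
  then show ?thesis
    using x y sym_form_swap[OF X x y]
    by (simp add: minus_scalar_prod_distrib[of _ n] scalar_prod_minus_distrib[of _ n]
        power2_eq_square algebra_simps)
qed

text \<open>
  The form of a positive semidefinite matrix is nonnegative on the whole line \<open>x - t y\<close>. The
  proof evaluates this quadratic polynomial in \<open>t\<close> at its minimum, or, when it is affine, at a point
  where a nonzero slope would make it negative.
\<close>

lemma form_Cauchy_Schwarz:
  assumes X: "sym_pos_semidef n X" and x: "x \<in> carrier_vec n" and y: "y \<in> carrier_vec n"
  shows "(x \<bullet> (X *\<^sub>v y))\<^sup>2 \<le> (x \<bullet> (X *\<^sub>v x)) * (y \<bullet> (X *\<^sub>v y))"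
proof -
  define a b c where "a = x \<bullet> (X *\<^sub>v x)" and "b = x \<bullet> (X *\<^sub>v y)" and "c = y \<bullet> (X *\<^sub>v y)"
  have nonneg: "0 \<le> a - 2 * t * b + t\<^sup>2 * c" for t
  proof -
    have "sym_mat n X" using X by (simp add: sym_pos_semidef_iff)
    then show ?thesis
      unfolding a_def b_def c_def form_minus_smult[OF \<open>sym_mat n X\<close> x y, symmetric]
      using X x y by (auto simp: sym_pos_semidef_iff)
  qed
  have "0 \<le> c" using X y by (auto simp: sym_pos_semidef_iff c_def)
  show ?thesis
  proof (cases "c = 0")
    case True
    have "b = 0"
    proof (rule ccontr)
      assume "b \<noteq> 0"
      \<comment> \<open>At this \<open>t\<close> the affine function \<open>a - 2 t b\<close> takes the value \<open>-1\<close>.\<close>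
      then show False using nonneg[of "(a + 1) / (2 * b)"] nonneg[of 0] True by simp
    qed
    then show ?thesis using True by (simp add: a_def b_def c_def)
  next
    case False
    then have "0 < c" using \<open>0 \<le> c\<close> by simp
    have "a - 2 * (b / c) * b + (b / c)\<^sup>2 * c = a - b\<^sup>2 / c"
      using False by (simp add: power2_eq_square field_simps)
    then have "b\<^sup>2 / c \<le> a" using nonneg[of "b / c"] by simp
    then show ?thesis using \<open>0 < c\<close> by (simp add: a_def b_def c_def field_simps)
  qed
qed

lemma sym_pos_semidef_one: "sym_pos_semidef n (1\<^sub>m n)"
  by (auto simp: sym_pos_semidef_def real_scalar_prod_self_nonneg)

lemma real_Cauchy_Schwarz:
  "(x :: real vec) \<in> carrier_vec n \<Longrightarrow> y \<in> carrier_vec n \<Longrightarrow> (x \<bullet> y)\<^sup>2 \<le> (x \<bullet> x) * (y \<bullet> y)"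
  using form_Cauchy_Schwarz[OF sym_pos_semidef_one, of x n y] by simp

lemma mat_inv_props:
  assumes X: "X \<in> carrier_mat n n"
    and inj: "\<And>v. v \<in> carrier_vec n \<Longrightarrow> X *\<^sub>v v = 0\<^sub>v n \<Longrightarrow> v = 0\<^sub>v n"
  shows "mat_inv X \<in> carrier_mat n n" "X * mat_inv X = 1\<^sub>m n" "mat_inv X * X = 1\<^sub>m n"
proof -
  have "det X \<noteq> 0" using det_0_iff_vec_prod_zero_field[OF X] inj by blast
  from det_non_zero_imp_unit[OF X this, of "()"] mat_inverse(1)[OF X, of "()"]
  obtain Y where "mat_inverse X = Some Y" by (cases "mat_inverse X") auto
  then show "mat_inv X \<in> carrier_mat n n" "X * mat_inv X = 1\<^sub>m n" "mat_inv X * X = 1\<^sub>m n"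
    using mat_inverse(2)[OF X] by (auto simp: mat_inv_def)
qed

lemma sym_mat_inv:
  assumes X: "sym_mat n X" and Y: "Y \<in> carrier_mat n n" and XY: "X * Y = 1\<^sub>m n"
    and YX: "Y * X = 1\<^sub>m n"
  shows "sym_mat n Y"
proof -
  have Xc: "X \<in> carrier_mat n n" using sym_matD[OF X] by simp
  have "transpose_mat Y * X = 1\<^sub>m n"
    using transpose_mult[OF Xc Y] XY sym_matD[OF X] by simp
  have "transpose_mat Y = transpose_mat Y * (X * Y)" using XY Y by simp
  also have "\<dots> = (transpose_mat Y * X) * Y"
    using Xc Y by (subst assoc_mult_mat[of _ n n _ n _ n]) auto
  also have "\<dots> = Y" using \<open>transpose_mat Y * X = 1\<^sub>m n\<close> Y by simp
  finally show ?thesis using Y by (simp add: sym_mat_def)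
qed

text \<open>
  The infimum \<open>m\<close> of the Rayleigh quotients is an eigenvalue. The matrix \<open>C = X - m\<close> is positive
  semidefinite. If it were invertible, the form of its inverse would be bounded by some \<open>L\<close>, and the
  Cauchy-Schwarz inequality for \<open>C\<close> would give \<open>v \<bullet> C v \<ge> (v \<bullet> v) / L\<close>: the Rayleigh quotients of
  \<open>X\<close> would stay above \<open>m + 1 / L\<close>.
\<close>

lemma least_eigenvalue_exists:
  assumes X: "sym_mat n X" and n: "n > 0"
  obtains m where "eigenvalue X m" "\<And>v. v \<in> carrier_vec n \<Longrightarrow> m * (v \<bullet> v) \<le> v \<bullet> (X *\<^sub>v v)"
proof -
  have Xc: "X \<in> carrier_mat n n" using sym_matD[OF X] by simp
  define Q where "Q = (\<lambda>v. v \<bullet> (X *\<^sub>v v) / (v \<bullet> v)) ` (carrier_vec n - {0\<^sub>v n})"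
  define m where "m = Inf Q"
  obtain K where K: "0 < K" "\<And>v. v \<in> carrier_vec n \<Longrightarrow> \<bar>v \<bullet> (X *\<^sub>v v)\<bar> \<le> K * (v \<bullet> v)"
    using form_bounded[OF Xc] by blast
  have bdd: "bdd_below Q"
  proof (rule bdd_belowI)
    fix q assume "q \<in> Q"
    then obtain v where v: "v \<in> carrier_vec n" "v \<noteq> 0\<^sub>v n" "q = v \<bullet> (X *\<^sub>v v) / (v \<bullet> v)"
      by (auto simp: Q_def)
    have "- K * (v \<bullet> v) \<le> q * (v \<bullet> v)"
      using K(2)[OF v(1)] v(3) real_scalar_prod_self_pos[OF v(1,2)] by (simp add: abs_le_iff)
    then show "- K \<le> q" using real_scalar_prod_self_pos[OF v(1,2)] by (rule mult_right_le_imp_le)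
  qed
  have ne: "Q \<noteq> {}"
  proof -
    have "unit_vec n 0 \<noteq> (0\<^sub>v n :: real vec)" using n by (auto simp: vec_eq_iff unit_vec_def)
    then have "unit_vec n 0 \<in> carrier_vec n - {0\<^sub>v n :: real vec}" by simp
    then show ?thesis unfolding Q_def by blast
  qed
  have low: "m * (v \<bullet> v) \<le> v \<bullet> (X *\<^sub>v v)" if v: "v \<in> carrier_vec n" for v
  proof (cases "v = 0\<^sub>v n")
    case True
    then show ?thesis using Xc by (auto intro: mult_mat_vec_carrier)
  next
    case False
    then have "m \<le> v \<bullet> (X *\<^sub>v v) / (v \<bullet> v)"
      unfolding m_def using bdd v by (auto simp: Q_def intro!: cInf_lower)
    then show ?thesis using real_scalar_prod_self_pos[OF v False] by (simp add: field_simps)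
  qed
  define C where "C = X - m \<cdot>\<^sub>m 1\<^sub>m n"
  have Cc: "C \<in> carrier_mat n n" unfolding C_def by (intro minus_carrier_mat) simp
  have Cv: "C *\<^sub>v v = X *\<^sub>v v - m \<cdot>\<^sub>v v" if "v \<in> carrier_vec n" for v
    using Xc that by (simp add: C_def minus_mult_distrib_mat_vec[of _ n n] smult_mat_mult_vec[of _ n n])
  have formC: "v \<bullet> (C *\<^sub>v v) = v \<bullet> (X *\<^sub>v v) - m * (v \<bullet> v)" if "v \<in> carrier_vec n" for v
    using that Xc by (simp add: Cv scalar_prod_minus_distrib[of _ n] mult_mat_vec_carrier[OF Xc])
  have Csym: "sym_mat n C"
    using X Xc by (auto simp: C_def sym_mat_def transpose_minus)
  have Cpsd: "sym_pos_semidef n C"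
    using Csym low by (auto simp: sym_pos_semidef_iff formC)
  have "\<exists>v \<in> carrier_vec n. v \<noteq> 0\<^sub>v n \<and> C *\<^sub>v v = 0\<^sub>v n"
  proof (rule ccontr)
    assume "\<not> ?thesis"
    then have inj: "\<And>v. v \<in> carrier_vec n \<Longrightarrow> C *\<^sub>v v = 0\<^sub>v n \<Longrightarrow> v = 0\<^sub>v n" by blast
    define D where "D = mat_inv C"
    have D: "D \<in> carrier_mat n n" "C * D = 1\<^sub>m n" "D * C = 1\<^sub>m n"
      using mat_inv_props[OF Cc inj] by (auto simp: D_def)
    obtain L where L: "0 < L" "\<And>v. v \<in> carrier_vec n \<Longrightarrow> \<bar>v \<bullet> (D *\<^sub>v v)\<bar> \<le> L * (v \<bullet> v)"
      using form_bounded[OF D(1)] by blast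
    \<comment> \<open>Cauchy-Schwarz for the form of \<open>C\<close> at \<open>v\<close> and \<open>w = C\<^sup>-\<^sup>1 v\<close>.\<close>
    have gap: "v \<bullet> v \<le> L * (v \<bullet> (C *\<^sub>v v))" if v: "v \<in> carrier_vec n" "v \<noteq> 0\<^sub>v n" for v
    proof -
      define w where "w = D *\<^sub>v v"
      have w: "w \<in> carrier_vec n" "C *\<^sub>v w = v"
        using D Cc v by (auto simp: w_def assoc_mult_mat_vec[of C n n D n, symmetric])
      have "(v \<bullet> v)\<^sup>2 \<le> (v \<bullet> (C *\<^sub>v v)) * (w \<bullet> v)"
        using form_Cauchy_Schwarz[OF Cpsd v(1) w(1)] w by simp
      also have "w \<bullet> v = v \<bullet> (D *\<^sub>v v)"
        using comm_scalar_prod[OF w(1) v(1)] by (simp add: w_def)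
      also have "(v \<bullet> (C *\<^sub>v v)) * (v \<bullet> (D *\<^sub>v v)) \<le> (v \<bullet> (C *\<^sub>v v)) * (L * (v \<bullet> v))"
        using L(2)[OF v(1)] Cpsd v by (intro mult_left_mono) (auto simp: sym_pos_semidef_iff)
      finally show ?thesis
        using real_scalar_prod_self_pos[OF v] by (simp add: power2_eq_square field_simps)
    qed
    have "m + 1 / L \<le> Inf Q"
    proof (rule cInf_greatest[OF ne])
      fix q assume "q \<in> Q"
      then obtain v where v: "v \<in> carrier_vec n" "v \<noteq> 0\<^sub>v n" "q = v \<bullet> (X *\<^sub>v v) / (v \<bullet> v)"
        by (auto simp: Q_def)
      have vv: "0 < v \<bullet> v" using real_scalar_prod_self_pos[OF v(1,2)] .
      have "(v \<bullet> v) / L \<le> v \<bullet> (C *\<^sub>v v)" using gap[OF v(1,2)] L(1) by (simp add: field_simps)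
      then have "(m + 1 / L) * (v \<bullet> v) \<le> q * (v \<bullet> v)"
        using formC[OF v(1)] v(3) vv by (simp add: algebra_simps)
      then show "m + 1 / L \<le> q" using vv by (rule mult_right_le_imp_le)
    qed
    then show False using L(1) by (simp add: m_def)
  qed
  then obtain v where v: "v \<in> carrier_vec n" "v \<noteq> 0\<^sub>v n" "C *\<^sub>v v = 0\<^sub>v n" by blast
  have "X *\<^sub>v v = m \<cdot>\<^sub>v v"
  proof (rule eq_vecI)
    fix i assume "i < dim_vec (m \<cdot>\<^sub>v v)"
    then have i: "i < n" using v by simp
    then have "(X *\<^sub>v v - m \<cdot>\<^sub>v v) $ i = 0" using v Cv[OF v(1)] by simp
    then show "(X *\<^sub>v v) $ i = (m \<cdot>\<^sub>v v) $ i" using i v Xc by simp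
  qed (use Xc v in auto)
  then have "eigenvalue X m"
    using v Xc by (auto simp: eigenvalue_def eigenvector_def)
  then show ?thesis using low that by blast
qed

lemma greatest_eigenvalue_exists:
  assumes X: "sym_mat n X" and n: "n > 0"
  obtains m where "eigenvalue X m" "\<And>v. v \<in> carrier_vec n \<Longrightarrow> v \<bullet> (X *\<^sub>v v) \<le> m * (v \<bullet> v)"
proof -
  have Xc: "X \<in> carrier_mat n n" using sym_matD[OF X] by simp
  have "sym_mat n (- X)" using X by (auto simp: sym_mat_def transpose_uminus)
  then obtain m where m: "eigenvalue (- X) m"
    "\<And>v. v \<in> carrier_vec n \<Longrightarrow> m * (v \<bullet> v) \<le> v \<bullet> (- X *\<^sub>v v)"
    using least_eigenvalue_exists[OF _ n] by blast
  from m(1) obtain v where v: "v \<in> carrier_vec n" "v \<noteq> 0\<^sub>v n" "- X *\<^sub>v v = m \<cdot>\<^sub>v v"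
    using Xc by (auto simp: eigenvalue_def eigenvector_def)
  then have "X *\<^sub>v v = - m \<cdot>\<^sub>v v"
    using Xc by (auto simp: vec_eq_iff minus_equation_iff)
  then have "eigenvalue X (- m)" using v Xc by (auto simp: eigenvalue_def eigenvector_def)
  moreover have "v \<bullet> (X *\<^sub>v v) \<le> - m * (v \<bullet> v)" if "v \<in> carrier_vec n" for v
    using m(2)[OF that] Xc that by simp
  ultimately show ?thesis using that by blast
qed

text \<open>
  The extreme Rayleigh quotients are eigenvalues, so the smallest and the largest eigenvalue bound
  all of them. This is what makes Rayleigh quotients admissible parameters.
\<close>

lemma spectrum_sym_bounds:
  assumes X: "sym_mat n X" and n: "n > 0"
  shows "finite (spectrum X)" "spectrum X \<noteq> {}"
    and "v \<in> carrier_vec n \<Longrightarrow> Min (spectrum X) * (v \<bullet> v) \<le> v \<bullet> (X *\<^sub>v v)"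
    and "v \<in> carrier_vec n \<Longrightarrow> v \<bullet> (X *\<^sub>v v) \<le> Max (spectrum X) * (v \<bullet> v)"
proof -
  show fin: "finite (spectrum X)" using card_finite_spectrum(1)[OF sym_matD(1)[OF X]] .
  obtain m where m: "eigenvalue X m" "\<And>v. v \<in> carrier_vec n \<Longrightarrow> m * (v \<bullet> v) \<le> v \<bullet> (X *\<^sub>v v)"
    using least_eigenvalue_exists[OF X n] by blast
  obtain M where M: "eigenvalue X M" "\<And>v. v \<in> carrier_vec n \<Longrightarrow> v \<bullet> (X *\<^sub>v v) \<le> M * (v \<bullet> v)"
    using greatest_eigenvalue_exists[OF X n] by blast
  show "spectrum X \<noteq> {}" using m(1) by (auto simp: spectrum_def)
  have "Min (spectrum X) \<le> m" "M \<le> Max (spectrum X)"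
    using fin m(1) M(1) by (auto simp: spectrum_def)
  then show "v \<in> carrier_vec n \<Longrightarrow> Min (spectrum X) * (v \<bullet> v) \<le> v \<bullet> (X *\<^sub>v v)"
    "v \<in> carrier_vec n \<Longrightarrow> v \<bullet> (X *\<^sub>v v) \<le> Max (spectrum X) * (v \<bullet> v)"
    using m(2)[of v] M(2)[of v] mult_right_mono[OF _ real_scalar_prod_self_nonneg[of v]]
    by fastforce+
qed

section \<open>Square roots of positive definite matrices\<close>

lemma mult3_mat_vec:
  assumes "(T :: real mat) \<in> carrier_mat m n" "X \<in> carrier_mat n k" "U \<in> carrier_mat k l"
    and "x \<in> carrier_vec l"
  shows "(T * X * U) *\<^sub>v x = T *\<^sub>v (X *\<^sub>v (U *\<^sub>v x))"
proof -
  have "(T * X * U) *\<^sub>v x = (T * X) *\<^sub>v (U *\<^sub>v x)"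
    using assms by (intro assoc_mult_mat_vec[of _ m k _ l]) auto
  also have "\<dots> = T *\<^sub>v (X *\<^sub>v (U *\<^sub>v x))"
    using assms by (intro assoc_mult_mat_vec[of _ m n _ k]) auto
  finally show ?thesis .
qed

lemma form_congruence:
  assumes T: "(T :: real mat) \<in> carrier_mat m n" and X: "X \<in> carrier_mat n n"
    and x: "x \<in> carrier_vec m"
  shows "x \<bullet> ((T * X * transpose_mat T) *\<^sub>v x) =
    (transpose_mat T *\<^sub>v x) \<bullet> (X *\<^sub>v (transpose_mat T *\<^sub>v x))"
proof -
  have "(T * X * transpose_mat T) *\<^sub>v x = T *\<^sub>v (X *\<^sub>v (transpose_mat T *\<^sub>v x))"
    using T X x by (intro mult3_mat_vec) auto
  then show ?thesis
    using transpose_vec_mult_scalar[OF T _ x, of "X *\<^sub>v (transpose_mat T *\<^sub>v x)"] T X x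
    by (simp add: mult_mat_vec_carrier[OF X])
qed

lemma sym_mat_congruence:
  assumes T: "(T :: real mat) \<in> carrier_mat m n" and X: "sym_mat n X"
  shows "sym_mat m (T * X * transpose_mat T)"
proof -
  have Xc: "X \<in> carrier_mat n n" using sym_matD[OF X] by simp
  have "transpose_mat (T * X * transpose_mat T) = T * transpose_mat (T * X)"
    using T Xc by (subst transpose_mult[of _ m n _ m]) auto
  also have "\<dots> = T * (X * transpose_mat T)"
    using T Xc sym_matD(2)[OF X] by (subst transpose_mult[of _ m n _ n]) auto
  also have "\<dots> = T * X * transpose_mat T"
    using T Xc by (intro assoc_mult_mat[symmetric]) auto
  finally show ?thesis
    unfolding sym_mat_def using T Xc by (intro conjI mult_carrier_mat[of _ m n]) auto
qed

lemma sym_pos_semidef_congruence: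
  assumes T: "(T :: real mat) \<in> carrier_mat m n" and X: "sym_pos_semidef n X"
  shows "sym_pos_semidef m (T * X * transpose_mat T)"
  unfolding sym_pos_semidef_iff
proof (intro conjI ballI)
  have Xs: "sym_mat n X" using X by (simp add: sym_pos_semidef_iff)
  show "sym_mat m (T * X * transpose_mat T)" using sym_mat_congruence[OF T Xs] .
  fix x :: "real vec" assume x: "x \<in> carrier_vec m"
  then have "transpose_mat T *\<^sub>v x \<in> carrier_vec n" using T by auto
  then show "0 \<le> x \<bullet> ((T * X * transpose_mat T) *\<^sub>v x)"
    unfolding form_congruence[OF T sym_matD(1)[OF Xs] x] using X by (auto simp: sym_pos_semidef_iff)
qed

lemma sym_pos_semidef_form_eq_0:
  assumes X: "sym_pos_semidef n X" and v: "v \<in> carrier_vec n" and 0: "v \<bullet> (X *\<^sub>v v) = 0"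
  shows "X *\<^sub>v v = 0\<^sub>v n"
proof -
  have w: "X *\<^sub>v v \<in> carrier_vec n" using X v by (auto simp: sym_pos_semidef_def)
  have "((X *\<^sub>v v) \<bullet> (X *\<^sub>v v))\<^sup>2 \<le> 0"
    using form_Cauchy_Schwarz[OF X w v] 0 by simp
  then show ?thesis using real_scalar_prod_self_eq_0_iff[OF w] by simp
qed

lemma mat_eq_if_mult_vec_eq:
  assumes A: "(A :: real mat) \<in> carrier_mat m n" and B: "B \<in> carrier_mat m n"
    and eq: "\<And>v. v \<in> carrier_vec n \<Longrightarrow> A *\<^sub>v v = B *\<^sub>v v"
  shows "A = B"
proof (rule eq_matI)
  fix i j assume ij: "i < dim_row B" "j < dim_col B"
  have "(A *\<^sub>v unit_vec n j) $ i = (B *\<^sub>v unit_vec n j) $ i" by (simp add: eq)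
  then show "A $$ (i, j) = B $$ (i, j)" using ij A B by simp
qed (use A B in auto)

text \<open>
  The Householder reflection \<open>1 - 2 w w\<^sup>T / (w \<bullet> w)\<close> along \<open>w = v - e\<close> exchanges the unit vectors \<open>e\<close>
  and \<open>v\<close>. It serves to move an eigenvector to the first coordinate axis by a matrix that is
  symmetric and its own inverse.
\<close>

lemma reflection_exists:
  assumes v: "(v :: real vec) \<in> carrier_vec n" and unit: "v \<bullet> v = 1" and n: "n > 0"
  obtains H where "sym_mat n H" "H * H = 1\<^sub>m n" "H *\<^sub>v unit_vec n 0 = v"
proof (cases "v = unit_vec n 0")
  case True
  then show ?thesis using that[of "1\<^sub>m n"] v by (auto simp: sym_mat_def)
next
  case False
  define e where "e = (unit_vec n 0 :: real vec)"
  have e: "e \<in> carrier_vec n" "e \<bullet> e = 1" using n by (auto simp: e_def)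
  define w where "w = v - e"
  have w: "w \<in> carrier_vec n" using v e by (simp add: w_def)
  have ve: "v = e + w" using v e by (auto simp: w_def vec_eq_iff)
  have "w \<noteq> 0\<^sub>v n" using False v e ve by (auto simp: e_def[symmetric])
  then have ww: "0 < w \<bullet> w" using real_scalar_prod_self_pos[OF w] by simp
  define c where "c = 2 / (w \<bullet> w)"
  define H where "H = mat n n (\<lambda>(i, j). (if i = j then 1 else 0) - c * (w $ i * w $ j))"
  have Hc: "H \<in> carrier_mat n n" by (simp add: H_def)
  have Hx: "H *\<^sub>v x = x - (c * (w \<bullet> x)) \<cdot>\<^sub>v w" if x: "x \<in> carrier_vec n" for x
  proof (rule eq_vecI)
    fix i assume "i < dim_vec (x - (c * (w \<bullet> x)) \<cdot>\<^sub>v w)"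
    then have i: "i < n" using w by simp
    have "(H *\<^sub>v x) $ i = (\<Sum>j\<in>{0..<n}. (if i = j then x $ j else 0) - c * w $ i * (w $ j * x $ j))"
      using i x by (auto simp: H_def scalar_prod_def algebra_simps intro!: sum.cong)
    also have "\<dots> = x $ i - c * w $ i * (w \<bullet> x)"
      using i x by (simp add: sum_subtractf scalar_prod_def sum_distrib_left)
    finally show "(H *\<^sub>v x) $ i = (x - (c * (w \<bullet> x)) \<cdot>\<^sub>v w) $ i"
      using i x w by (simp add: mult_ac)
  qed (use w Hc in auto)
  have "H * H = 1\<^sub>m n"
  proof (rule mat_eq_if_mult_vec_eq[of _ n n])
    fix x :: "real vec" assume x: "x \<in> carrier_vec n"
    define t where "t = c * (w \<bullet> x)"
    have "c * (w \<bullet> (x - t \<cdot>\<^sub>v w)) = t - t * (c * (w \<bullet> w))"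
      using x w by (simp add: scalar_prod_minus_distrib[of _ n] t_def algebra_simps)
    also have "\<dots> = - t" using ww by (simp add: c_def)
    finally have "H *\<^sub>v (H *\<^sub>v x) = x - t \<cdot>\<^sub>v w - (- t) \<cdot>\<^sub>v w"
      using x w by (simp add: Hx t_def)
    then have "H *\<^sub>v (H *\<^sub>v x) = x" using x w by (auto simp: vec_eq_iff)
    then show "(H * H) *\<^sub>v x = 1\<^sub>m n *\<^sub>v x" using x Hc by simp
  qed (use Hc in auto)
  moreover have "sym_mat n H"
  proof -
    have "transpose_mat H = H" by (rule eq_matI) (auto simp: H_def mult.commute)
    then show ?thesis using Hc by (simp add: sym_mat_def)
  qed
  moreover have "H *\<^sub>v e = v"
  proof -
    have "v \<bullet> v = e \<bullet> e + 2 * (w \<bullet> e) + w \<bullet> w"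
      using e w comm_scalar_prod[OF e(1) w]
      by (simp add: ve add_scalar_prod_distrib[of _ n] scalar_prod_add_distrib[of _ n])
    \<comment> \<open>The two unit lengths cancel, so the reflection adds exactly \<open>w\<close> to \<open>e\<close>.\<close>
    then have "w \<bullet> w = - 2 * (w \<bullet> e)" using unit e by simp
    then have "c * (w \<bullet> e) = -1" using ww by (simp add: c_def field_simps)
    then show ?thesis using Hx[OF e(1)] e w by (auto simp: ve vec_eq_iff)
  qed
  ultimately show ?thesis using that by (simp add: e_def)
qed

text \<open>
  Induction on the dimension. Conjugating with a reflection that moves an eigenvector to the first axis
  splits off a \<open>1 \<times> 1\<close> block that holds the eigenvalue; the remaining block is again positive
  semidefinite and has a square root by the induction hypothesis.
\<close>

lemma sqrt_exists:
  assumes "sym_pos_semidef n X"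
  shows "\<exists>Y. sym_pos_semidef n Y \<and> Y * Y = X"
  using assms
proof (induction n arbitrary: X)
  case 0
  then show ?case by (intro exI[of _ X]) (auto simp: sym_pos_semidef_def)
next
  case (Suc n X)
  have Xs: "sym_mat (Suc n) X" and Xc: "X \<in> carrier_mat (Suc n) (Suc n)"
    using Suc.prems by (auto simp: sym_pos_semidef_iff sym_matD)
  obtain l where "eigenvalue X l" using least_eigenvalue_exists[OF Xs] by auto
  then obtain u where u: "u \<in> carrier_vec (Suc n)" "u \<noteq> 0\<^sub>v (Suc n)" "X *\<^sub>v u = l \<cdot>\<^sub>v u"
    using Xc by (auto simp: eigenvalue_def eigenvector_def)
  have uu: "0 < u \<bullet> u" using real_scalar_prod_self_pos[OF u(1,2)] .
  have "0 \<le> u \<bullet> (X *\<^sub>v u)" using Suc.prems u by (auto simp: sym_pos_semidef_def)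
  then have l: "0 \<le> l" using u uu by (simp add: zero_le_mult_iff)
  define v where "v = (1 / sqrt (u \<bullet> u)) \<cdot>\<^sub>v u"
  have v: "v \<in> carrier_vec (Suc n)" "X *\<^sub>v v = l \<cdot>\<^sub>v v"
    using u by (auto simp: v_def mult_mat_vec[OF Xc u(1)] smult_smult_assoc mult.commute)
  have "v \<bullet> v = 1" using u uu by (simp add: v_def)
  then obtain H where H: "sym_mat (Suc n) H" "H * H = 1\<^sub>m (Suc n)" "H *\<^sub>v unit_vec (Suc n) 0 = v"
    using reflection_exists[OF v(1)] by auto
  have Hc: "H \<in> carrier_mat (Suc n) (Suc n)" and Ht: "transpose_mat H = H"
    using H(1) by (auto simp: sym_mat_def)
  define M where "M = H * X * transpose_mat H"
  have Mpsd: "sym_pos_semidef (Suc n) M"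
    using sym_pos_semidef_congruence[OF Hc Suc.prems] by (simp add: M_def)
  then have Mc: "M \<in> carrier_mat (Suc n) (Suc n)" and Mt: "transpose_mat M = M"
    by (auto simp: sym_pos_semidef_def)
  have "M *\<^sub>v unit_vec (Suc n) 0 = H *\<^sub>v (X *\<^sub>v v)"
    unfolding M_def Ht using Hc Xc H(3) by (subst mult3_mat_vec) auto
  also have "\<dots> = l \<cdot>\<^sub>v ((H * H) *\<^sub>v unit_vec (Suc n) 0)"
    using Hc v H(3) by (simp add: mult_mat_vec[OF Hc])
  also have "\<dots> = l \<cdot>\<^sub>v unit_vec (Suc n) 0" by (simp add: H(2))
  finally have Me: "M *\<^sub>v unit_vec (Suc n) 0 = l \<cdot>\<^sub>v unit_vec (Suc n) 0" .
  have M0: "M $$ (i, 0) = (if i = 0 then l else 0)" if "i < Suc n" for i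
  proof -
    have "(M *\<^sub>v unit_vec (Suc n) 0) $ i = M $$ (i, 0)" using that Mc by simp
    then show ?thesis using that unfolding Me by (cases i) auto
  qed
  have M0': "M $$ (0, i) = (if i = 0 then l else 0)" if "i < Suc n" for i
  proof -
    have "M $$ (0, i) = transpose_mat M $$ (i, 0)" using that Mc by simp
    then show ?thesis using M0[OF that] by (simp add: Mt)
  qed
  \<comment> \<open>The first row and column of \<open>M\<close> vanish off the diagonal; \<open>X'\<close> is the remaining block, and
    \<open>D t Z\<close> is block diagonal with blocks \<open>t\<close> and \<open>Z\<close>.\<close>
  define X' where "X' = mat n n (\<lambda>(i, j). M $$ (Suc i, Suc j))"
  have X'c: "X' \<in> carrier_mat n n" by (simp add: X'_def)
  define D where "D = (\<lambda>t (Z :: real mat). four_block_mat (t \<cdot>\<^sub>m 1\<^sub>m 1) (0\<^sub>m 1 n) (0\<^sub>m n 1) Z)"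
  have M_eq: "M = D l X'"
    using M0 M0' Mc
    by (intro eq_matI) (auto simp: D_def X'_def less_Suc_eq_0_disj)
  have D_vec: "D t Z *\<^sub>v (a @\<^sub>v d) = (t \<cdot>\<^sub>v a) @\<^sub>v (Z *\<^sub>v d)"
    if "a \<in> carrier_vec 1" "d \<in> carrier_vec n" "Z \<in> carrier_mat n n" for t Z a d
    using that unfolding D_def
    by (subst mult_mat_vec_split[of _ 1 _ n])
       (auto simp: smult_mat_mult_vec[of _ 1 1])
  have D_form: "(a @\<^sub>v d) \<bullet> (D t Z *\<^sub>v (a @\<^sub>v d)) = t * (a \<bullet> a) + d \<bullet> (Z *\<^sub>v d)"
    if "a \<in> carrier_vec 1" "d \<in> carrier_vec n" "Z \<in> carrier_mat n n" for t Z a d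
    using that by (simp add: D_vec scalar_prod_append[of _ 1 _ n] mult_mat_vec_carrier[of _ n n])
  have D_sym: "sym_mat (Suc n) (D t Z)" if "sym_mat n Z" for t Z
  proof -
    have "transpose_mat (t \<cdot>\<^sub>m 1\<^sub>m 1) = t \<cdot>\<^sub>m (1\<^sub>m 1 :: real mat)" by (rule eq_matI) auto
    then show ?thesis
      using that by (auto simp: sym_mat_def D_def transpose_four_block_mat[of _ 1 1 _ n _ n])
  qed
  have X't: "transpose_mat X' = X'"
  proof (rule eq_matI)
    fix i j assume "i < dim_row X'" "j < dim_col X'"
    then have "i < n" "j < n" using X'c by auto
    moreover have "M $$ (Suc j, Suc i) = transpose_mat M $$ (Suc i, Suc j)"
      using Mc \<open>i < n\<close> \<open>j < n\<close> by simp
    ultimately show "transpose_mat X' $$ (i, j) = X' $$ (i, j)" by (simp add: X'_def Mt)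
  qed (use X'c in auto)
  have "sym_pos_semidef n X'"
    unfolding sym_pos_semidef_def
  proof (intro conjI ballI X'c X't)
    fix d :: "real vec" assume d: "d \<in> carrier_vec n"
    have "0\<^sub>v 1 @\<^sub>v d \<in> carrier_vec (Suc n)"
      using append_carrier_vec[of "0\<^sub>v 1" 1 d n] d by simp
    then have "0 \<le> (0\<^sub>v 1 @\<^sub>v d) \<bullet> (M *\<^sub>v (0\<^sub>v 1 @\<^sub>v d))" using Mpsd by (auto simp: sym_pos_semidef_def)
    then show "0 \<le> d \<bullet> (X' *\<^sub>v d)" using D_form[OF _ d X'c, of "0\<^sub>v 1" l] by (simp add: M_eq)
  qed
  from Suc.IH[OF this] obtain Z where Z: "sym_pos_semidef n Z" "Z * Z = X'" by blast
  have Zc: "Z \<in> carrier_mat n n" using Z by (simp add: sym_pos_semidef_def)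
  define L where "L = D (sqrt l) Z"
  have Lpsd: "sym_pos_semidef (Suc n) L"
    unfolding sym_pos_semidef_iff
  proof (intro conjI ballI)
    show "sym_mat (Suc n) L" using D_sym Z by (simp add: L_def sym_pos_semidef_iff)
    fix x :: "real vec" assume x: "x \<in> carrier_vec (Suc n)"
    define a d where "a = vec_first x 1" and "d = vec_last x n"
    have ad: "a \<in> carrier_vec 1" "d \<in> carrier_vec n" "x = a @\<^sub>v d"
      using vec_first_last_append[of x 1 n] x by (auto simp: a_def d_def)
    show "0 \<le> x \<bullet> (L *\<^sub>v x)"
      unfolding ad(3) L_def D_form[OF ad(1,2) Zc]
      using Z ad(2) l real_scalar_prod_self_nonneg[of a] by (simp add: sym_pos_semidef_def)
  qed
  have Lc: "L \<in> carrier_mat (Suc n) (Suc n)" using Lpsd by (simp add: sym_pos_semidef_def)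
  have "L * L = M"
  proof -
    have "(sqrt l \<cdot>\<^sub>m 1\<^sub>m 1) * (sqrt l \<cdot>\<^sub>m 1\<^sub>m 1) = l \<cdot>\<^sub>m (1\<^sub>m 1 :: real mat)"
      using l by (intro eq_matI) auto
    then show ?thesis
      unfolding L_def D_def M_eq using Zc Z(2) X'c
      by (subst mult_four_block_mat[of _ 1 1 _ n _ n _ _ 1 _ n]) simp_all
  qed
  define Y where "Y = H * L * transpose_mat H"
  have Ypsd: "sym_pos_semidef (Suc n) Y"
    using sym_pos_semidef_congruence[OF Hc Lpsd] by (simp add: Y_def)
  then have Yc: "Y \<in> carrier_mat (Suc n) (Suc n)" by (simp add: sym_pos_semidef_def)
  have "Y * Y = X"
  proof (rule mat_eq_if_mult_vec_eq[of _ "Suc n" "Suc n"])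
    fix x :: "real vec" assume x: "x \<in> carrier_vec (Suc n)"
    have HH: "H *\<^sub>v (H *\<^sub>v y) = y" if "y \<in> carrier_vec (Suc n)" for y
      using that Hc H(2) by (simp add: assoc_mult_mat_vec[symmetric, of H "Suc n" "Suc n" H "Suc n"])
    have LL: "L *\<^sub>v (L *\<^sub>v y) = H *\<^sub>v (X *\<^sub>v (H *\<^sub>v y))" if "y \<in> carrier_vec (Suc n)" for y
    proof -
      have "L *\<^sub>v (L *\<^sub>v y) = M *\<^sub>v y"
        using that Lc \<open>L * L = M\<close> by (simp add: assoc_mult_mat_vec[symmetric, of L "Suc n" "Suc n" L "Suc n"])
      then show ?thesis
        unfolding M_def Ht using that Hc Xc by (simp add: mult3_mat_vec del: assoc_mult_mat)
    qed
    show "(Y * Y) *\<^sub>v x = X *\<^sub>v x"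
    proof -
      have Yv: "Y *\<^sub>v y = H *\<^sub>v (L *\<^sub>v (H *\<^sub>v y))" if "y \<in> carrier_vec (Suc n)" for y
        unfolding Y_def Ht using that Hc Lc by (intro mult3_mat_vec) auto
      have "(Y * Y) *\<^sub>v x = Y *\<^sub>v (Y *\<^sub>v x)" using Yc x by (intro assoc_mult_mat_vec) auto
      also have "\<dots> = H *\<^sub>v (L *\<^sub>v (L *\<^sub>v (H *\<^sub>v x)))"
        using x Hc Lc by (simp add: Yv HH mult_mat_vec_carrier[OF Hc] mult_mat_vec_carrier[OF Lc])
      also have "\<dots> = X *\<^sub>v x"
        using x Hc Xc by (simp add: LL HH mult_mat_vec_carrier[OF Hc] mult_mat_vec_carrier[OF Xc])
      finally show ?thesis .
    qed
  qed (use Yc Xc in auto)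
  then show ?case using Ypsd by blast
qed

lemma sym_pos_semidef_inj_imp_def:
  assumes X: "sym_pos_semidef n X"
    and inj: "\<And>v. v \<in> carrier_vec n \<Longrightarrow> X *\<^sub>v v = 0\<^sub>v n \<Longrightarrow> v = 0\<^sub>v n"
  shows "sym_pos_def n X"
  unfolding sym_pos_def_iff
proof (intro conjI ballI impI)
  show "sym_mat n X" using X by (simp add: sym_pos_semidef_iff)
  fix v :: "real vec" assume v: "v \<in> carrier_vec n" "v \<noteq> 0\<^sub>v n"
  have "v \<bullet> (X *\<^sub>v v) \<noteq> 0"
    using sym_pos_semidef_form_eq_0[OF X v(1)] inj[OF v(1)] v(2) by blast
  moreover have "0 \<le> v \<bullet> (X *\<^sub>v v)" using X v by (simp add: sym_pos_semidef_iff)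
  ultimately show "0 < v \<bullet> (X *\<^sub>v v)" by simp
qed

lemma sym_pos_def_inj:
  assumes "sym_pos_def n X" "v \<in> carrier_vec n" "X *\<^sub>v v = 0\<^sub>v n"
  shows "v = 0\<^sub>v n"
  using assms by (auto simp: sym_pos_def_def)

lemma sqrt_of_sym_pos_def:
  assumes X: "sym_pos_def n X" and Y: "sym_pos_semidef n Y" and YY: "Y * Y = X"
  shows "sym_pos_def n Y"
proof (rule sym_pos_semidef_inj_imp_def[OF Y])
  fix v :: "real vec" assume v: "v \<in> carrier_vec n" "Y *\<^sub>v v = 0\<^sub>v n"
  have Yc: "Y \<in> carrier_mat n n" using Y by (simp add: sym_pos_semidef_def)
  have "X *\<^sub>v v = Y *\<^sub>v (Y *\<^sub>v v)" using Yc v by (simp flip: YY)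
  also have "\<dots> = 0\<^sub>v n" using Yc v by auto
  finally show "v = 0\<^sub>v n" using sym_pos_def_inj[OF X] v by blast
qed

lemma sym_mat_eq_0_if_eigenvalues_0:
  assumes X: "sym_mat n X" and ev: "\<And>k. eigenvalue X k \<Longrightarrow> k = 0"
  shows "X = 0\<^sub>m n n"
proof (cases "n = 0")
  case True
  then show ?thesis using sym_matD(1)[OF X] by auto
next
  case False
  have Xc: "X \<in> carrier_mat n n" using sym_matD[OF X] by simp
  from False have n: "n > 0" by simp
  obtain m where m: "eigenvalue X m" "\<And>v. v \<in> carrier_vec n \<Longrightarrow> m * (v \<bullet> v) \<le> v \<bullet> (X *\<^sub>v v)"
    using least_eigenvalue_exists[OF X n] by blast
  obtain M where M: "eigenvalue X M" "\<And>v. v \<in> carrier_vec n \<Longrightarrow> v \<bullet> (X *\<^sub>v v) \<le> M * (v \<bullet> v)"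
    using greatest_eigenvalue_exists[OF X n] by blast
  have form: "v \<bullet> (X *\<^sub>v v) = 0" if "v \<in> carrier_vec n" for v
    using m(2)[OF that] M(2)[OF that] ev[OF m(1)] ev[OF M(1)] by simp
  then have "sym_pos_semidef n X" using X by (simp add: sym_pos_semidef_iff)
  then have "X *\<^sub>v v = 0\<^sub>v n" if "v \<in> carrier_vec n" for v
    using sym_pos_semidef_form_eq_0 that form by blast
  then show ?thesis using Xc by (intro mat_eq_if_mult_vec_eq[of _ n n]) auto
qed

text \<open>
  Let \<open>D = Y - Z\<close>. From \<open>Y Y = Z Z\<close> follows \<open>D Y + Z D = 0\<close>. Evaluated at an eigenvector \<open>v\<close> of
  \<open>D\<close> for \<open>k\<close> this reads \<open>k (v \<bullet> Y v + v \<bullet> Z v) = 0\<close>, and the bracket is positive. So all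
  eigenvalues of the symmetric matrix \<open>D\<close> are zero.
\<close>

lemma sqrt_unique:
  assumes X: "sym_pos_def n X" and Y: "sym_pos_semidef n Y" "Y * Y = X"
    and Z: "sym_pos_semidef n Z" "Z * Z = X"
  shows "Y = Z"
proof -
  have Yc: "Y \<in> carrier_mat n n" and Zc: "Z \<in> carrier_mat n n"
    using Y Z by (auto simp: sym_pos_semidef_def)
  define D where "D = Y - Z"
  have Dc: "D \<in> carrier_mat n n" unfolding D_def using Zc by (rule minus_carrier_mat)
  have D: "sym_mat n D" 
  proof -
    have "transpose_mat D = transpose_mat Y - transpose_mat Z"
      unfolding D_def by (rule transpose_minus[OF Yc Zc])
    then show ?thesis using Y(1) Z(1) Dc by (simp add: sym_mat_def D_def sym_pos_semidef_def)
  qed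
  have "D = 0\<^sub>m n n"
  proof (rule sym_mat_eq_0_if_eigenvalues_0[OF D])
    fix k assume "eigenvalue D k"
    then obtain v where v: "v \<in> carrier_vec n" "v \<noteq> 0\<^sub>v n" "D *\<^sub>v v = k \<cdot>\<^sub>v v"
      using Dc by (auto simp: eigenvalue_def eigenvector_def)
    have Yv: "Y *\<^sub>v v \<in> carrier_vec n" and Zv: "Z *\<^sub>v v \<in> carrier_vec n" using Yc Zc v by auto
    have YYv: "Y *\<^sub>v (Y *\<^sub>v v) = Z *\<^sub>v (Z *\<^sub>v v)"
      using Y(2) Z(2) assoc_mult_mat_vec[OF Yc Yc v(1)] assoc_mult_mat_vec[OF Zc Zc v(1)] by simp
    have Dx: "D *\<^sub>v x = Y *\<^sub>v x - Z *\<^sub>v x" if "x \<in> carrier_vec n" for x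
      using that Yc Zc by (simp add: D_def minus_mult_distrib_mat_vec[of _ n n])
    have "v \<bullet> (D *\<^sub>v (Y *\<^sub>v v)) = k * (v \<bullet> (Y *\<^sub>v v))"
      using sym_form_swap[OF D v(1) Yv] v Yv comm_scalar_prod[OF v(1) Yv] by simp
    moreover have "v \<bullet> (Z *\<^sub>v (D *\<^sub>v v)) = k * (v \<bullet> (Z *\<^sub>v v))"
      using v Zv by (simp add: mult_mat_vec[OF Zc])
    moreover have "v \<bullet> (D *\<^sub>v (Y *\<^sub>v v)) + v \<bullet> (Z *\<^sub>v (D *\<^sub>v v)) = 0"
      using v(1) Yv Zv YYv
      by (simp add: Dx mult_minus_distrib_mat_vec[OF Zc] mult_mat_vec_carrier[OF Zc]
          scalar_prod_minus_distrib[of _ n])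
    ultimately have "k * (v \<bullet> (Y *\<^sub>v v) + v \<bullet> (Z *\<^sub>v v)) = 0" by (simp add: algebra_simps)
    moreover have "0 < v \<bullet> (Y *\<^sub>v v) + v \<bullet> (Z *\<^sub>v v)"
    proof (rule add_pos_nonneg)
      show "0 < v \<bullet> (Y *\<^sub>v v)"
        using sqrt_of_sym_pos_def[OF X Y] v(1,2) by (simp add: sym_pos_def_iff)
      show "0 \<le> v \<bullet> (Z *\<^sub>v v)" using Z(1) v(1) by (simp add: sym_pos_semidef_iff)
    qed
    ultimately show "k = 0" by simp
  qed
  then have "(Y - Z) $$ (i, j) = 0" if "i < n" "j < n" for i j
    using that by (simp add: D_def)
  then show ?thesis
    using Yc Zc by (intro eq_matI) auto
qed

lemma mat_sqrt_props:
  assumes X: "sym_pos_def n X"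
  shows "sym_pos_def n (mat_sqrt X)" "mat_sqrt X * mat_sqrt X = X"
proof -
  have dim: "dim_row X = n" using X by (auto simp: sym_pos_def_def)
  obtain Y where Y: "sym_pos_semidef n Y \<and> Y * Y = X"
    using sqrt_exists sym_pos_def_imp_semidef[OF X] by blast
  then have "\<exists>!Y. sym_pos_semidef n Y \<and> Y * Y = X"
    using sqrt_unique[OF X] by (intro ex1I[of _ Y]) auto
  from theI'[OF this] have "sym_pos_semidef n (mat_sqrt X) \<and> mat_sqrt X * mat_sqrt X = X"
    by (simp add: mat_sqrt_def dim)
  then show "sym_pos_def n (mat_sqrt X)" "mat_sqrt X * mat_sqrt X = X"
    using sqrt_of_sym_pos_def[OF X] by auto
qed

lemma inv_sqrt_props:
  assumes X: "sym_pos_def n X"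
  shows "sym_mat n (inv_sqrt X)" "inv_sqrt X * mat_sqrt X = 1\<^sub>m n" "mat_sqrt X * inv_sqrt X = 1\<^sub>m n"
proof -
  have Y: "sym_pos_def n (mat_sqrt X)" using mat_sqrt_props[OF X] by simp
  then have Ys: "sym_mat n (mat_sqrt X)" by (simp only: sym_pos_def_iff)
  then have Yc: "mat_sqrt X \<in> carrier_mat n n" by (rule sym_matD)
  note inv = mat_inv_props[OF Yc sym_pos_def_inj[OF Y], folded inv_sqrt_def]
  show "sym_mat n (inv_sqrt X)"
    using sym_mat_inv[OF Ys inv(1,2,3)] .
  show "inv_sqrt X * mat_sqrt X = 1\<^sub>m n" "mat_sqrt X * inv_sqrt X = 1\<^sub>m n"
    using inv by simp_all
qed

section \<open>Vectors and matrices composed of blocks\<close>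

definition vec_block :: "(nat \<Rightarrow> nat) \<Rightarrow> real vec \<Rightarrow> nat \<Rightarrow> real vec" where
  "vec_block n w k = vec (n k) (\<lambda>i. w $ (block_start n k + i))"

lemma vec_block_carrier [simp]: "vec_block n w k \<in> carrier_vec (n k)"
  by (simp add: vec_block_def)

lemma dim_vec_block [simp]: "dim_vec (vec_block n w k) = n k"
  by (simp add: vec_block_def)

lemma index_vec_block [simp]: "i < n k \<Longrightarrow> vec_block n w k $ i = w $ (block_start n k + i)"
  by (simp add: vec_block_def)

lemma block_start_0 [simp]: "block_start n 0 = 0"
  by (simp add: block_start_def)

lemma block_start_Suc [simp]: "block_start n (Suc k) = block_start n k + n k"
  by (simp add: block_start_def)

lemma block_start_mono: "k \<le> l \<Longrightarrow> block_start n k \<le> block_start n l"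
  by (auto simp: block_start_def intro!: sum_mono2)

lemma block_index_less: "k < m \<Longrightarrow> i < n k \<Longrightarrow> block_start n k + i < block_start n m"
  using block_start_mono[of "Suc k" m n] by simp

lemma block_no_eq: "i < n k \<Longrightarrow> block_no n (block_start n k + i) = k"
  unfolding block_no_def
proof (rule Least_equality)
  fix l assume "i < n k" "block_start n k + i < block_start n (Suc l)"
  then show "k \<le> l" using block_start_mono[of "Suc l" k n] by (cases "k \<le> l") auto
qed simp

lemma block_index_exists:
  "j < block_start n m \<Longrightarrow> \<exists>k i. k < m \<and> i < n k \<and> j = block_start n k + i"
proof (induction m)
  case (Suc m)
  show ?case
  proof (cases "j < block_start n m")
    case True
    with Suc.IH show ?thesis by (metis less_Suc_eq)
  next
    case False
    with Suc.prems show ?thesis by (intro exI[of _ m] exI[of _ "j - block_start n m"]) auto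
  qed
qed simp

lemma sum_lessThan_add:
  "(\<Sum>j<a + b. g j) = (\<Sum>j<a. g j) + (\<Sum>i<b. g (a + i :: nat) :: real)"
  by (induction b) (simp_all add: add.assoc)

lemma sum_blocks:
  "(\<Sum>j<block_start n m. g j :: real) = (\<Sum>l<m. \<Sum>i<n l. g (block_start n l + i))"
  by (induction m) (simp_all add: sum_lessThan_add)

lemma scalar_prod_blocks:
  assumes "w \<in> carrier_vec (block_start n m)"
  shows "v \<bullet> w = (\<Sum>l<m. vec_block n v l \<bullet> vec_block n w l)"
proof -
  have "v \<bullet> w = (\<Sum>j<block_start n m. v $ j * w $ j)"
    using assms by (simp add: scalar_prod_def atLeast0LessThan)
  then show ?thesis by (simp add: sum_blocks scalar_prod_def atLeast0LessThan)
qed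

lemma eq_0_if_vec_blocks_0:
  assumes "w \<in> carrier_vec (block_start n m)" "\<And>k. k < m \<Longrightarrow> vec_block n w k = 0\<^sub>v (n k)"
  shows "w = 0\<^sub>v (block_start n m)"
  using scalar_prod_blocks[OF assms(1), of w] assms real_scalar_prod_self_eq_0_iff[OF assms(1)]
  by simp

lemma block_mat_carrier [simp]:
  "block_mat N n F \<in> carrier_mat (block_start n (Suc N)) (block_start n (Suc N))"
  by (simp add: block_mat_def)

lemma index_block_mat:
  assumes "k \<le> N" "l \<le> N" "i < n k" "j < n l"
  shows "block_mat N n F $$ (block_start n k + i, block_start n l + j) = F k l $$ (i, j)"
  using assms block_index_less[of k "Suc N" i n] block_index_less[of l "Suc N" j n]
  by (simp add: block_mat_def block_no_eq)

lemma block_mat_eqI: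
  assumes "X \<in> carrier_mat (block_start n (Suc N)) (block_start n (Suc N))"
    and "\<And>k l i j. k \<le> N \<Longrightarrow> l \<le> N \<Longrightarrow> i < n k \<Longrightarrow> j < n l \<Longrightarrow>
      X $$ (block_start n k + i, block_start n l + j) = F k l $$ (i, j)"
  shows "X = block_mat N n F"
proof (rule eq_matI)
  fix i j assume "i < dim_row (block_mat N n F)" "j < dim_col (block_mat N n F)"
  then have "i < block_start n (Suc N)" "j < block_start n (Suc N)"
    by (simp_all add: block_mat_def)
  then obtain k i' l j' where "k \<le> N" "i' < n k" "i = block_start n k + i'"
    "l \<le> N" "j' < n l" "j = block_start n l + j'"
    by (metis block_index_exists less_Suc_eq_le)
  then show "X $$ (i, j) = block_mat N n F $$ (i, j)"
    using assms(2) by (simp add: index_block_mat)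
qed (use assms(1) in \<open>simp_all add: block_mat_def\<close>)

lemma sym_mat_block_mat:
  assumes "\<And>k l. k \<le> N \<Longrightarrow> l \<le> N \<Longrightarrow> F k l \<in> carrier_mat (n k) (n l)"
    and "\<And>k l. k \<le> N \<Longrightarrow> l \<le> N \<Longrightarrow> F k l = transpose_mat (F l k)"
  shows "sym_mat (block_start n (Suc N)) (block_mat N n F)"
proof -
  have "transpose_mat (block_mat N n F) = block_mat N n F"
  proof (rule block_mat_eqI)
    fix k l i j assume kl: "k \<le> N" "l \<le> N" "i < n k" "j < n l"
    then have "transpose_mat (block_mat N n F) $$ (block_start n k + i, block_start n l + j) =
      F l k $$ (j, i)"
      using block_index_less[of k "Suc N" i n] block_index_less[of l "Suc N" j n]
      by (simp add: index_block_mat block_mat_def block_no_eq)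
    also have "\<dots> = F k l $$ (i, j)"
      using kl assms(1)[of l k] assms(2)[of k l] by simp
    finally show "transpose_mat (block_mat N n F) $$ (block_start n k + i, block_start n l + j) =
      F k l $$ (i, j)" .
  qed (simp add: block_mat_def)
  then show ?thesis unfolding sym_mat_def using block_mat_carrier by blast
qed

lemma index_block_mat_mult_vec:
  assumes F: "\<And>l. l \<le> N \<Longrightarrow> F k l \<in> carrier_mat (n k) (n l)"
    and w: "w \<in> carrier_vec (block_start n (Suc N))" and k: "k \<le> N" and i: "i < n k"
  shows "vec_block n (block_mat N n F *\<^sub>v w) k $ i = (\<Sum>l\<le>N. (F k l *\<^sub>v vec_block n w l) $ i)"
proof -
  let ?p = "block_start n k + i"
  have p: "?p < block_start n (Suc N)" using k i by (intro block_index_less) auto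
  have "vec_block n (block_mat N n F *\<^sub>v w) k $ i = row (block_mat N n F) ?p \<bullet> w"
    using i p by (simp add: block_mat_def)
  also have "\<dots> = (\<Sum>j<block_start n (Suc N). block_mat N n F $$ (?p, j) * w $ j)"
    using w p by (simp add: scalar_prod_def atLeast0LessThan block_mat_def)
  also have "\<dots> = (\<Sum>l<Suc N. \<Sum>j<n l. block_mat N n F $$ (?p, block_start n l + j) * w $ (block_start n l + j))"
    by (rule sum_blocks)
  also have "\<dots> = (\<Sum>l<Suc N. \<Sum>j<n l. F k l $$ (i, j) * vec_block n w l $ j)"
    using k i by (intro sum.cong) (auto simp: index_block_mat)
  also have "\<dots> = (\<Sum>l<Suc N. (F k l *\<^sub>v vec_block n w l) $ i)"
  proof (intro sum.cong refl)
    fix l assume "l \<in> {..<Suc N}"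
    then have "F k l \<in> carrier_mat (n k) (n l)" using F by simp
    then show "(\<Sum>j<n l. F k l $$ (i, j) * vec_block n w l $ j) = (F k l *\<^sub>v vec_block n w l) $ i"
      using i by (simp add: scalar_prod_def atLeast0LessThan)
  qed
  finally show ?thesis by (simp add: lessThan_Suc_atMost)
qed

lemma vec_block_tridiag_mat_mult:
  assumes A: "\<And>k. k \<le> N \<Longrightarrow> A k \<in> carrier_mat (n k) (n k)"
    and B: "\<And>k. k \<in> {1..N} \<Longrightarrow> B k \<in> carrier_mat (n k) (n (k - 1))"
    and w: "w \<in> carrier_vec (block_start n (Suc N))" and k: "k \<le> N"
  shows "vec_block n (tridiag_mat N n A B *\<^sub>v w) k =
    ((-1) ^ k) \<cdot>\<^sub>v (A k *\<^sub>v vec_block n w k)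
    + (if 0 < k then B k *\<^sub>v vec_block n w (k - 1) else 0\<^sub>v (n k))
    + (if k < N then transpose_mat (B (Suc k)) *\<^sub>v vec_block n w (Suc k) else 0\<^sub>v (n k))"
    (is "_ = ?a + ?b + ?c")
proof (rule eq_vecI)
  have Bk: "0 < k \<Longrightarrow> B k \<in> carrier_mat (n k) (n (k - 1))"
    and BSk: "k < N \<Longrightarrow> B (Suc k) \<in> carrier_mat (n (Suc k)) (n k)"
    using B[of k] B[of "Suc k"] k by auto
  have dims: "?a \<in> carrier_vec (n k)" "?b \<in> carrier_vec (n k)" "?c \<in> carrier_vec (n k)"
    using A[OF k] Bk BSk by auto
  show "dim_vec (vec_block n (tridiag_mat N n A B *\<^sub>v w) k) = dim_vec (?a + ?b + ?c)"
    using dims by simp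
  fix i assume "i < dim_vec (?a + ?b + ?c)"
  then have i: "i < n k" using dims by simp
  let ?F = "\<lambda>k l. if k = l then (-1) ^ k \<cdot>\<^sub>m A k
     else if k = Suc l then B k
     else if l = Suc k then transpose_mat (B l)
     else 0\<^sub>m (n k) (n l)"
  have F: "?F k l \<in> carrier_mat (n k) (n l)" if "l \<le> N" for l
    using that k A[of k] B[of k] B[of l] by auto
  \<comment> \<open>At most three blocks of row \<open>k\<close> are nonzero; written as a sum of three conditional terms, each
    of them is summed over \<open>l\<close> separately.\<close>
  have summand: "(?F k l *\<^sub>v vec_block n w l) $ i =
      (if l = k then ?a $ i else 0) + (if k = Suc l then ?b $ i else 0)
      + (if l = Suc k then ?c $ i else 0)" if "l \<le> N" for l
    using that i k A[OF k] Bk BSk by (auto simp: smult_mat_mult_vec[of _ "n k" "n k"])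
  have "vec_block n (tridiag_mat N n A B *\<^sub>v w) k $ i = (\<Sum>l\<le>N. (?F k l *\<^sub>v vec_block n w l) $ i)"
    unfolding tridiag_mat_def by (rule index_block_mat_mult_vec[where F = ?F, OF F w k i])
  also have "\<dots> = (\<Sum>l\<le>N. (if l = k then ?a $ i else 0) + (if k = Suc l then ?b $ i else 0)
      + (if l = Suc k then ?c $ i else 0))"
    by (rule sum.cong) (simp_all only: summand atMost_iff)
  also have "\<dots> = (\<Sum>l\<le>N. if l = k then ?a $ i else 0) + (\<Sum>l\<le>N. if k = Suc l then ?b $ i else 0)
      + (\<Sum>l\<le>N. if l = Suc k then ?c $ i else 0)"
    by (simp only: sum.distrib)
  also have "(\<Sum>l\<le>N. if l = k then ?a $ i else 0) = ?a $ i"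
    using k by simp
  also have "(\<Sum>l\<le>N. if k = Suc l then ?b $ i else 0) = ?b $ i"
  proof (cases k)
    case 0
    then show ?thesis using i by simp
  next
    case (Suc k')
    then have "(\<Sum>l\<le>N. if k = Suc l then ?b $ i else 0) = (\<Sum>l\<le>N. if l = k' then ?b $ i else 0)"
      by (intro sum.cong) auto
    then show ?thesis using Suc k by simp
  qed
  also have "(\<Sum>l\<le>N. if l = Suc k then ?c $ i else 0) = ?c $ i"
    using i k by (cases "k < N") auto
  finally show "vec_block n (tridiag_mat N n A B *\<^sub>v w) k $ i = (?a + ?b + ?c) $ i"
    using dims i by simp
qed

lemma sym_mat_tridiag_mat:
  assumes A: "\<And>k. k \<le> N \<Longrightarrow> sym_mat (n k) (A k)"
    and B: "\<And>k. k \<in> {1..N} \<Longrightarrow> B k \<in> carrier_mat (n k) (n (k - 1))"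
  shows "sym_mat (block_start n (Suc N)) (tridiag_mat N n A B)"
  unfolding tridiag_mat_def
proof (rule sym_mat_block_mat, goal_cases)
  case (1 k l)
  then show ?case using sym_matD(1)[OF A[of k]] B[of k] B[of l] by auto
next
  case (2 k l)
  have "transpose_mat ((-1) ^ k \<cdot>\<^sub>m A k) = (-1) ^ k \<cdot>\<^sub>m transpose_mat (A k)"
    by (rule eq_matI) auto
  then show ?case using sym_matD(2)[OF A[of k]] 2 by auto
qed

lemma precond_mat_eq_block_mat:
  assumes S: "\<And>k. k \<le> N \<Longrightarrow> S k \<in> carrier_mat (n k) (n k)"
  shows "precond_mat N S = block_mat N n (\<lambda>k l. if k = l then S k else 0\<^sub>m (n k) (n l))"
proof (rule block_mat_eqI)
  have dims: "dim_row (diag_block_mat (map S [0..<m])) = block_start n m"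
    "dim_col (diag_block_mat (map S [0..<m])) = block_start n m" if "m \<le> Suc N" for m
    using that S
    by (induction m) (auto simp: dim_diag_block_mat)
  show "precond_mat N S \<in> carrier_mat (block_start n (Suc N)) (block_start n (Suc N))"
    using dims[of "Suc N"] unfolding precond_mat_def by (intro carrier_matI) simp_all
  fix k l i j
  have "diag_block_mat (map S [0..<m]) $$ (block_start n k + i, block_start n l + j) =
      (if k = l then S k else 0\<^sub>m (n k) (n l)) $$ (i, j)"
    if "m \<le> Suc N" "k < m" "l < m" "i < n k" "j < n l" for m
    using that
  proof (induction m)
    case (Suc m)
    let ?D = "diag_block_mat (map S [0..<m])"
    have D: "dim_row ?D = block_start n m" "dim_col ?D = block_start n m"
      using dims[of m] Suc.prems by auto
    have Sm: "S m \<in> carrier_mat (n m) (n m)" using S[of m] Suc.prems by simp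
    have step: "diag_block_mat (map S [0..<Suc m]) =
      four_block_mat ?D (0\<^sub>m (block_start n m) (n m)) (0\<^sub>m (n m) (block_start n m)) (S m)"
      using D Sm by (simp add: diag_block_mat_last Let_def)
    have lt: "k < m \<Longrightarrow> block_start n k + i < block_start n m"
      "l < m \<Longrightarrow> block_start n l + j < block_start n m"
      using Suc.prems by (auto intro: block_index_less)
    show ?case
      using Suc D Sm lt unfolding step
      by (cases "k = m"; cases "l = m") (auto simp: less_Suc_eq)
  qed simp
  then show "k \<le> N \<Longrightarrow> l \<le> N \<Longrightarrow> i < n k \<Longrightarrow> j < n l \<Longrightarrow>
    precond_mat N S $$ (block_start n k + i, block_start n l + j) =
      (if k = l then S k else 0\<^sub>m (n k) (n l)) $$ (i, j)"
    by (simp only: precond_mat_def less_Suc_eq_le order_refl)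
qed

lemma vec_block_precond_mat_mult:
  assumes S: "\<And>k. k \<le> N \<Longrightarrow> S k \<in> carrier_mat (n k) (n k)"
    and w: "w \<in> carrier_vec (block_start n (Suc N))" and k: "k \<le> N"
  shows "vec_block n (precond_mat N S *\<^sub>v w) k = S k *\<^sub>v vec_block n w k"
proof (rule eq_vecI)
  fix i assume "i < dim_vec (S k *\<^sub>v vec_block n w k)"
  then have i: "i < n k" using S[OF k] by simp
  let ?F = "\<lambda>k l. if k = l then S k else 0\<^sub>m (n k) (n l)"
  have F: "?F k l \<in> carrier_mat (n k) (n l)" if "l \<le> N" for l using that S by auto
  have P_eq: "precond_mat N S = block_mat N n ?F"
    using S by (rule precond_mat_eq_block_mat)
  have "vec_block n (precond_mat N S *\<^sub>v w) k $ i = (\<Sum>l\<le>N. (?F k l *\<^sub>v vec_block n w l) $ i)"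
    unfolding P_eq by (rule index_block_mat_mult_vec[where F = ?F, OF F w k i])
  also have "\<dots> = (\<Sum>l\<le>N. if l = k then (S k *\<^sub>v vec_block n w k) $ i else 0)"
    using i by (intro sum.cong) auto
  finally show "vec_block n (precond_mat N S *\<^sub>v w) k $ i = (S k *\<^sub>v vec_block n w k) $ i"
    using k by simp
qed (use S[OF k] in auto)

lemma sym_pos_def_precond_mat:
  assumes S: "\<And>k. k \<le> N \<Longrightarrow> sym_pos_def (n k) (S k)"
  shows "sym_pos_def (block_start n (Suc N)) (precond_mat N S)"
  unfolding sym_pos_def_iff
proof (intro conjI ballI impI)
  have Ss: "sym_mat (n k) (S k)" if "k \<le> N" for k using S[OF that] by (simp only: sym_pos_def_iff)
  have Sc: "S k \<in> carrier_mat (n k) (n k)" if "k \<le> N" for k by (rule sym_matD(1)[OF Ss[OF that]])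
  have P_eq: "precond_mat N S = block_mat N n (\<lambda>k l. if k = l then S k else 0\<^sub>m (n k) (n l))"
    using Sc by (rule precond_mat_eq_block_mat)
  show "sym_mat (block_start n (Suc N)) (precond_mat N S)"
    unfolding P_eq
  proof (rule sym_mat_block_mat)
    fix k l assume "k \<le> N" "l \<le> N"
    then show "(if k = l then S k else 0\<^sub>m (n k) (n l)) \<in> carrier_mat (n k) (n l)"
      "(if k = l then S k else 0\<^sub>m (n k) (n l)) =
        transpose_mat (if l = k then S l else 0\<^sub>m (n l) (n k))"
      using Sc[of k] sym_matD(2)[OF Ss[of k]] by auto
  qed
  fix w :: "real vec" assume w: "w \<in> carrier_vec (block_start n (Suc N))" "w \<noteq> 0\<^sub>v (block_start n (Suc N))"
  obtain k where k: "k \<le> N" "vec_block n w k \<noteq> 0\<^sub>v (n k)"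
    using eq_0_if_vec_blocks_0[OF w(1)] w(2) by (metis less_Suc_eq_le)
  have Pw: "precond_mat N S *\<^sub>v w \<in> carrier_vec (block_start n (Suc N))"
    unfolding P_eq using mult_mat_vec_carrier[OF block_mat_carrier w(1)] .
  have "w \<bullet> (precond_mat N S *\<^sub>v w) = (\<Sum>l<Suc N. vec_block n w l \<bullet> (S l *\<^sub>v vec_block n w l))"
    unfolding scalar_prod_blocks[OF Pw]
    using vec_block_precond_mat_mult[OF Sc w(1)] by (intro sum.cong refl) simp
  also have "\<dots> > 0"
  proof (rule sum_pos2[of _ k])
    show "0 < vec_block n w k \<bullet> (S k *\<^sub>v vec_block n w k)"
      using S[OF k(1)] k(2) unfolding sym_pos_def_iff by simp
    fix l assume "l \<in> {..<Suc N}"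
    then show "0 \<le> vec_block n w l \<bullet> (S l *\<^sub>v vec_block n w l)"
      using sym_pos_def_imp_semidef[OF S[of l]] unfolding sym_pos_semidef_iff by simp
  qed (use k in auto)
  finally show "0 < w \<bullet> (precond_mat N S *\<^sub>v w)" .
qed

section \<open>The three-term recurrence of an eigenvector\<close>

lemma map_vec_mult_real_mat:
  assumes X: "X \<in> carrier_mat m n" and v: "v \<in> carrier_vec n"
  shows "map_vec Re (map_mat complex_of_real X *\<^sub>v v) = X *\<^sub>v map_vec Re v"
    and "map_vec Im (map_mat complex_of_real X *\<^sub>v v) = X *\<^sub>v map_vec Im v"
  using assms by (auto simp: scalar_prod_def)

text \<open>
  Write the complex eigenvector as \<open>a + i b\<close>. Multiplication with \<open>P\<close> turns the eigenvalue equation into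
  two real equations for \<open>A a\<close> and \<open>A b\<close>. Symmetry of \<open>A\<close>, in the form \<open>b \<bullet> A a = a \<bullet> A b\<close>, forces
  \<open>Im \<mu> (a \<bullet> P a + b \<bullet> P b) = 0\<close>, and the bracket is positive. Then \<open>a\<close> and \<open>b\<close> both solve the
  equation, and one of them is nonzero.
\<close>

lemma real_generalized_eigenvector_exists:
  assumes P: "sym_pos_def m P" and A: "sym_mat m A"
    and ev: "eigenvalue (map_mat complex_of_real (mat_inv P * A)) \<mu>"
  obtains \<nu> w where "\<mu> = complex_of_real \<nu>" "w \<in> carrier_vec m" "w \<noteq> 0\<^sub>v m"
    "A *\<^sub>v w = \<nu> \<cdot>\<^sub>v (P *\<^sub>v w)"
proof -
  have Ps: "sym_mat m P" using P by (simp only: sym_pos_def_iff)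
  have Pc: "P \<in> carrier_mat m m" by (rule sym_matD(1)[OF Ps])
  have Ac: "A \<in> carrier_mat m m" by (rule sym_matD(1)[OF A])
  note inv = mat_inv_props[OF Pc sym_pos_def_inj[OF P]]
  define M where "M = mat_inv P * A"
  have Mc: "M \<in> carrier_mat m m" unfolding M_def using inv(1) Ac by (rule mult_carrier_mat)
  obtain v where v: "v \<in> carrier_vec m" "v \<noteq> 0\<^sub>v m"
    "map_mat complex_of_real M *\<^sub>v v = \<mu> \<cdot>\<^sub>v v"
    using ev Mc unfolding M_def[symmetric] by (auto simp: eigenvalue_def eigenvector_def)
  define a b where "a = map_vec Re v" and "b = map_vec Im v"
  have ab: "a \<in> carrier_vec m" "b \<in> carrier_vec m" using v by (auto simp: a_def b_def)
  have Ma: "M *\<^sub>v a = Re \<mu> \<cdot>\<^sub>v a - Im \<mu> \<cdot>\<^sub>v b"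
    unfolding a_def map_vec_mult_real_mat(1)[OF Mc v(1), symmetric] v(3)
    using v(1) by (auto simp: b_def)
  have Mb: "M *\<^sub>v b = Re \<mu> \<cdot>\<^sub>v b + Im \<mu> \<cdot>\<^sub>v a"
    unfolding b_def map_vec_mult_real_mat(2)[OF Mc v(1), symmetric] v(3)
    using v(1) by (auto simp: a_def)
  have A_PM: "A *\<^sub>v x = P *\<^sub>v (M *\<^sub>v x)" if x: "x \<in> carrier_vec m" for x
  proof -
    have "P * M = A"
      unfolding M_def using assoc_mult_mat[OF Pc inv(1) Ac] inv(2) Ac by simp
    then show ?thesis using assoc_mult_mat_vec[OF Pc Mc x] by simp
  qed
  have Pa: "P *\<^sub>v a \<in> carrier_vec m" and Pb: "P *\<^sub>v b \<in> carrier_vec m" using Pc ab by auto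
  have Aa: "A *\<^sub>v a = Re \<mu> \<cdot>\<^sub>v (P *\<^sub>v a) - Im \<mu> \<cdot>\<^sub>v (P *\<^sub>v b)"
    using ab by (simp add: A_PM Ma mult_minus_distrib_mat_vec[OF Pc] mult_mat_vec[OF Pc])
  have Ab: "A *\<^sub>v b = Re \<mu> \<cdot>\<^sub>v (P *\<^sub>v b) + Im \<mu> \<cdot>\<^sub>v (P *\<^sub>v a)"
    using ab by (simp add: A_PM Mb mult_add_distrib_mat_vec[OF Pc] mult_mat_vec[OF Pc])
  have "b \<bullet> (A *\<^sub>v a) = a \<bullet> (A *\<^sub>v b)" by (rule sym_form_swap[OF A ab(2,1)])
  then have "Im \<mu> * (a \<bullet> (P *\<^sub>v a) + b \<bullet> (P *\<^sub>v b)) = 0"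
    using ab Pa Pb sym_form_swap[OF Ps ab]
    by (simp add: Aa Ab scalar_prod_minus_distrib[of _ m] scalar_prod_add_distrib[of _ m] algebra_simps)
  moreover have ab0: "a \<noteq> 0\<^sub>v m \<or> b \<noteq> 0\<^sub>v m"
  proof (rule ccontr)
    assume "\<not> ?thesis"
    then have "a $ i = 0 \<and> b $ i = 0" if "i < m" for i using that by simp
    then have "v $ i = 0" if "i < m" for i
      using that v(1) by (auto simp: a_def b_def complex_eq_iff)
    then show False using v(1,2) by (auto simp: vec_eq_iff)
  qed
  moreover have "0 < a \<bullet> (P *\<^sub>v a) + b \<bullet> (P *\<^sub>v b)"
  proof -
    have "0 \<le> a \<bullet> (P *\<^sub>v a)" "0 \<le> b \<bullet> (P *\<^sub>v b)"
      using sym_pos_def_imp_semidef[OF P] ab unfolding sym_pos_semidef_iff by auto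
    moreover have "0 < a \<bullet> (P *\<^sub>v a) \<or> 0 < b \<bullet> (P *\<^sub>v b)"
      using P ab ab0 unfolding sym_pos_def_iff by auto
    ultimately show ?thesis by linarith
  qed
  ultimately have im: "Im \<mu> = 0" by simp
  then have "\<mu> = complex_of_real (Re \<mu>)" by (simp add: complex_eq_iff)
  moreover have "A *\<^sub>v a = Re \<mu> \<cdot>\<^sub>v (P *\<^sub>v a)" "A *\<^sub>v b = Re \<mu> \<cdot>\<^sub>v (P *\<^sub>v b)"
    using Pa Pb by (auto simp: Aa Ab im)
  ultimately show ?thesis using that ab ab0 by blast
qed

lemma sym_mat_E_mat:
  assumes "sym_mat m (A k)" "sym_pos_def m (S k)"
  shows "sym_mat m (E_mat A S k)"
  using sym_mat_congruence[OF sym_matD(1)[OF inv_sqrt_props(1)[OF assms(2)]] assms(1)]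
  by (simp add: E_mat_def sym_matD(2)[OF inv_sqrt_props(1)[OF assms(2)]])

lemma E_mat_form:
  assumes "sym_mat m (A k)" "sym_pos_def m (S k)" "v \<in> carrier_vec m"
  shows "v \<bullet> (E_mat A S k *\<^sub>v v) = (inv_sqrt (S k) *\<^sub>v v) \<bullet> (A k *\<^sub>v (inv_sqrt (S k) *\<^sub>v v))"
  using form_congruence[OF sym_matD(1)[OF inv_sqrt_props(1)[OF assms(2)]] sym_matD(1)[OF assms(1)] assms(3)]
  by (simp only: E_mat_def sym_matD(2)[OF inv_sqrt_props(1)[OF assms(2)]])

lemma inv_sqrt_inj:
  assumes S: "sym_pos_def m S" and v: "v \<in> carrier_vec m" and 0: "inv_sqrt S *\<^sub>v v = 0\<^sub>v m"
  shows "v = 0\<^sub>v m"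
proof -
  have T: "inv_sqrt S \<in> carrier_mat m m" by (rule sym_matD(1)[OF inv_sqrt_props(1)[OF S]])
  have Y: "mat_sqrt S \<in> carrier_mat m m" using mat_sqrt_props(1)[OF S] by (simp only: sym_pos_def_def)
  have "v = (mat_sqrt S * inv_sqrt S) *\<^sub>v v" using v by (simp add: inv_sqrt_props(3)[OF S])
  also have "\<dots> = mat_sqrt S *\<^sub>v (inv_sqrt S *\<^sub>v v)" by (rule assoc_mult_mat_vec[OF Y T v])
  also have "\<dots> = 0\<^sub>v m" unfolding 0 using Y by auto
  finally show ?thesis .
qed

text \<open>
  The vectors \<open>x k\<close> are the blocks of an eigenvector multiplied by the square roots of the \<open>S k\<close>. In
  these coordinates the preconditioner is the identity and the blocks of the matrix are the
  \<open>E\<^sub>k\<close>, with alternating signs, and the \<open>R\<^sub>k\<close>.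
\<close>

lemma block_recurrence_exists:
  fixes A B S :: "nat \<Rightarrow> real mat"
  assumes A: "\<And>k. k \<le> N \<Longrightarrow> sym_mat (n k) (A k)"
    and B: "\<And>k. k \<in> {1..N} \<Longrightarrow> B k \<in> carrier_mat (n k) (n (k - 1))"
    and S: "\<And>k. k \<le> N \<Longrightarrow> sym_pos_def (n k) (S k)"
    and ev: "eigenvalue (map_mat complex_of_real (mat_inv (precond_mat N S) * tridiag_mat N n A B)) \<mu>"
  obtains \<nu> x where "\<mu> = complex_of_real \<nu>"
    "\<And>k. k \<le> N \<Longrightarrow> x k \<in> carrier_vec (n k)"
    "\<exists>k\<le>N. x k \<noteq> 0\<^sub>v (n k)"
    "\<And>k. k \<le> N \<Longrightarrow> \<nu> \<cdot>\<^sub>v x k =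
      (-1) ^ k \<cdot>\<^sub>v (E_mat A S k *\<^sub>v x k)
      + (if 0 < k then R_mat B S k *\<^sub>v x (k - 1) else 0\<^sub>v (n k))
      + (if k < N then transpose_mat (R_mat B S (Suc k)) *\<^sub>v x (Suc k) else 0\<^sub>v (n k))"
proof -
  have Ac: "A k \<in> carrier_mat (n k) (n k)" if "k \<le> N" for k by (rule sym_matD(1)[OF A[OF that]])
  have Sc: "S k \<in> carrier_mat (n k) (n k)" if "k \<le> N" for k
    using S[OF that] by (simp only: sym_pos_def_def)
  have Ps: "sym_pos_def (block_start n (Suc N)) (precond_mat N S)"
    using S by (rule sym_pos_def_precond_mat)
  have As: "sym_mat (block_start n (Suc N)) (tridiag_mat N n A B)"
    using A B by (rule sym_mat_tridiag_mat)
  obtain \<nu> w where \<nu>: "\<mu> = complex_of_real \<nu>" and w: "w \<in> carrier_vec (block_start n (Suc N))"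
      "w \<noteq> 0\<^sub>v (block_start n (Suc N))"
      "tridiag_mat N n A B *\<^sub>v w = \<nu> \<cdot>\<^sub>v (precond_mat N S *\<^sub>v w)"
    using real_generalized_eigenvector_exists[OF Ps As ev] by blast
  have wc: "vec_block n w k \<in> carrier_vec (n k)" for k by simp
  define T Y x where "T = (\<lambda>k. inv_sqrt (S k))" and "Y = (\<lambda>k. mat_sqrt (S k))"
    and "x = (\<lambda>k. Y k *\<^sub>v vec_block n w k)"
  have T: "T k \<in> carrier_mat (n k) (n k)" "transpose_mat (T k) = T k" "T k * Y k = 1\<^sub>m (n k)"
    if "k \<le> N" for k
    using inv_sqrt_props[OF S[OF that]] by (simp_all only: T_def Y_def sym_mat_def)
  have T_eq: "inv_sqrt (S k) = T k" for k by (simp add: T_def)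
  have Y: "Y k \<in> carrier_mat (n k) (n k)" "Y k * Y k = S k" if "k \<le> N" for k
    using mat_sqrt_props[OF S[OF that]] by (simp_all only: Y_def sym_pos_def_def)
  have x: "x k \<in> carrier_vec (n k)" if "k \<le> N" for k
    unfolding x_def by (rule mult_mat_vec_carrier[OF Y(1)[OF that] wc[of k]])
  have Tx: "T k *\<^sub>v x k = vec_block n w k" if "k \<le> N" for k
    unfolding x_def using assoc_mult_mat_vec[OF T(1)[OF that] Y(1)[OF that] wc[of k]] T(3)[OF that]
    by simp
  have TS: "T k *\<^sub>v (S k *\<^sub>v vec_block n w k) = x k" if "k \<le> N" for k
  proof -
    have "S k *\<^sub>v vec_block n w k = Y k *\<^sub>v x k"
      unfolding x_def Y(2)[OF that, symmetric]
      by (rule assoc_mult_mat_vec[OF Y(1)[OF that] Y(1)[OF that] wc[of k]])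
    then show ?thesis
      using assoc_mult_mat_vec[OF T(1)[OF that] Y(1)[OF that] x[OF that]] T(3)[OF that] x[OF that]
      by simp
  qed
  have nz: "\<exists>k\<le>N. x k \<noteq> 0\<^sub>v (n k)"
  proof (rule ccontr)
    assume "\<not> ?thesis"
    then have "vec_block n w k = 0\<^sub>v (n k)" if "k < Suc N" for k
    proof -
      have "T k *\<^sub>v 0\<^sub>v (n k) = 0\<^sub>v (n k)"
        using T(1)[of k] that by (intro eq_vecI) auto
      then show ?thesis
        using Tx[of k] \<open>\<not> (\<exists>k\<le>N. x k \<noteq> 0\<^sub>v (n k))\<close> that by (simp add: less_Suc_eq_le)
    qed
    then show False using eq_0_if_vec_blocks_0[OF w(1)] w(2) by blast
  qed
  have rec: "\<nu> \<cdot>\<^sub>v x k =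
      (-1) ^ k \<cdot>\<^sub>v (E_mat A S k *\<^sub>v x k)
      + (if 0 < k then R_mat B S k *\<^sub>v x (k - 1) else 0\<^sub>v (n k))
      + (if k < N then transpose_mat (R_mat B S (Suc k)) *\<^sub>v x (Suc k) else 0\<^sub>v (n k))"
    if k: "k \<le> N" for k
  proof -
    let ?w = "vec_block n w"
    let ?a = "A k *\<^sub>v ?w k"
    let ?b = "if 0 < k then B k *\<^sub>v ?w (k - 1) else 0\<^sub>v (n k)"
    let ?c = "if k < N then transpose_mat (B (Suc k)) *\<^sub>v ?w (Suc k) else 0\<^sub>v (n k)"
    have Bk: "0 < k \<Longrightarrow> B k \<in> carrier_mat (n k) (n (k - 1))"
      and BSk: "k < N \<Longrightarrow> B (Suc k) \<in> carrier_mat (n (Suc k)) (n k)"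
      using B[of k] B[of "Suc k"] k by auto
    have dims: "?a \<in> carrier_vec (n k)" "?b \<in> carrier_vec (n k)" "?c \<in> carrier_vec (n k)"
      using Ac[OF k] Bk BSk by auto
    have "vec_block n (\<nu> \<cdot>\<^sub>v (precond_mat N S *\<^sub>v w)) k = \<nu> \<cdot>\<^sub>v (S k *\<^sub>v ?w k)"
    proof -
      have "vec_block n (\<nu> \<cdot>\<^sub>v (precond_mat N S *\<^sub>v w)) k = \<nu> \<cdot>\<^sub>v vec_block n (precond_mat N S *\<^sub>v w) k"
      proof (rule eq_vecI)
        fix i assume "i < dim_vec (\<nu> \<cdot>\<^sub>v vec_block n (precond_mat N S *\<^sub>v w) k)"
        then have i: "i < n k" by simp
        have "block_start n k + i < dim_row (precond_mat N S)"
          using block_index_less[of k "Suc N" i n] k i Ps unfolding sym_pos_def_def by auto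
        then show "vec_block n (\<nu> \<cdot>\<^sub>v (precond_mat N S *\<^sub>v w)) k $ i =
            (\<nu> \<cdot>\<^sub>v vec_block n (precond_mat N S *\<^sub>v w) k) $ i"
          using i by simp
      qed simp
      then show ?thesis using vec_block_precond_mat_mult[OF Sc w(1) k] by simp
    qed
    then have eq: "\<nu> \<cdot>\<^sub>v (S k *\<^sub>v ?w k) = (-1) ^ k \<cdot>\<^sub>v ?a + ?b + ?c"
      using vec_block_tridiag_mat_mult[OF Ac B w(1) k] by (simp only: w(3))
    have "\<nu> \<cdot>\<^sub>v x k = T k *\<^sub>v (\<nu> \<cdot>\<^sub>v (S k *\<^sub>v ?w k))"
      using TS[OF k] mult_mat_vec[OF T(1)[OF k] mult_mat_vec_carrier[OF Sc[OF k] wc[of k]]]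
      by simp
    also have "\<dots> = (-1) ^ k \<cdot>\<^sub>v (T k *\<^sub>v ?a) + T k *\<^sub>v ?b + T k *\<^sub>v ?c"
      unfolding eq using dims
      by (simp only: mult_add_distrib_mat_vec[OF T(1)[OF k]] mult_mat_vec[OF T(1)[OF k]]
          add_carrier_vec smult_carrier_vec)
    also have "T k *\<^sub>v ?a = E_mat A S k *\<^sub>v x k"
      unfolding E_mat_def T_eq Tx[OF k, symmetric]
      by (rule mult3_mat_vec[symmetric, OF T(1)[OF k] Ac[OF k] T(1)[OF k] x[OF k]])
    also have "T k *\<^sub>v ?b = (if 0 < k then R_mat B S k *\<^sub>v x (k - 1) else 0\<^sub>v (n k))"
    proof (cases "0 < k")
      case True
      then have k1: "k - 1 \<le> N" using k by simp
      have "T k *\<^sub>v (B k *\<^sub>v ?w (k - 1)) = R_mat B S k *\<^sub>v x (k - 1)"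
        unfolding R_mat_def T_eq Tx[OF k1, symmetric]
        by (rule mult3_mat_vec[symmetric, OF T(1)[OF k] Bk[OF True] T(1)[OF k1] x[OF k1]])
      then show ?thesis using True by simp
    qed (use T(1)[OF k] in auto)
    also have "T k *\<^sub>v ?c =
      (if k < N then transpose_mat (R_mat B S (Suc k)) *\<^sub>v x (Suc k) else 0\<^sub>v (n k))"
    proof (cases "k < N")
      case True
      then have k1: "Suc k \<le> N" by simp
      have "transpose_mat (R_mat B S (Suc k)) =
        transpose_mat (T k) * transpose_mat (T (Suc k) * B (Suc k))"
        unfolding R_mat_def T_eq diff_Suc_1
        using T(1)[OF k] T(1)[OF k1] BSk[OF True]
        by (intro transpose_mult[of _ "n (Suc k)" "n k" _ "n k"]) auto
      also have "transpose_mat (T (Suc k) * B (Suc k)) = transpose_mat (B (Suc k)) * transpose_mat (T (Suc k))"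
        by (rule transpose_mult[OF T(1)[OF k1] BSk[OF True]])
      finally have "transpose_mat (R_mat B S (Suc k)) = T k * (transpose_mat (B (Suc k)) * T (Suc k))"
        by (simp only: T(2)[OF k] T(2)[OF k1])
      also have "\<dots> = T k * transpose_mat (B (Suc k)) * T (Suc k)"
        using T(1)[OF k] T(1)[OF k1] BSk[OF True] by (intro assoc_mult_mat[symmetric]) auto
      finally have "transpose_mat (R_mat B S (Suc k)) *\<^sub>v x (Suc k) =
        T k *\<^sub>v (transpose_mat (B (Suc k)) *\<^sub>v (T (Suc k) *\<^sub>v x (Suc k)))"
        using mult3_mat_vec[OF T(1)[OF k] _ T(1)[OF k1] x[OF k1], of "transpose_mat (B (Suc k))"] BSk[OF True]
        by simp
      then show ?thesis using True Tx[OF k1] by simp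
    qed (use T(1)[OF k] in auto)
    finally show ?thesis .
  qed
  show ?thesis by (rule that[OF \<nu> x nz rec])
qed

section \<open>Ratios of consecutive polynomials and pivots\<close>

text \<open>
  With \<open>y = Z x\<close> the number \<open>x \<bullet> Z x\<close> is \<open>y \<bullet> Z\<^sup>-\<^sup>1 y\<close>, so the claim is that \<open>y \<bullet> Z\<^sup>-\<^sup>1 y = (y \<bullet> y) / z\<close>
  with \<open>z\<close> between the bounds for \<open>Z\<close>. Stating it through \<open>x\<close> avoids the inverse. For positive
  definite \<open>Z\<close> the lower bound for \<open>z\<close> is the ordinary Cauchy-Schwarz inequality and the upper bound
  is the one for the form of \<open>Z\<close>; the negative definite case is the positive one for \<open>- Z\<close>.
\<close>

lemma inverse_form_ratio:
  assumes Z: "sym_mat n Z" and 0: "(0 :: real) \<notin> {l..u}"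
    and bounds: "\<And>v. v \<in> carrier_vec n \<Longrightarrow> l * (v \<bullet> v) \<le> v \<bullet> (Z *\<^sub>v v) \<and> v \<bullet> (Z *\<^sub>v v) \<le> u * (v \<bullet> v)"
    and x: "x \<in> carrier_vec n" "x \<noteq> 0\<^sub>v n"
  shows "\<exists>z\<in>{l..u}. z * (x \<bullet> (Z *\<^sub>v x)) = (Z *\<^sub>v x) \<bullet> (Z *\<^sub>v x)"
proof -
  have pos: "\<exists>z\<in>{a..b}. z * (x \<bullet> (W *\<^sub>v x)) = (W *\<^sub>v x) \<bullet> (W *\<^sub>v x)"
    if W: "sym_mat n W" and a: "0 < a"
      and bounds: "\<And>v. v \<in> carrier_vec n \<Longrightarrow> a * (v \<bullet> v) \<le> v \<bullet> (W *\<^sub>v v) \<and> v \<bullet> (W *\<^sub>v v) \<le> b * (v \<bullet> v)"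
    for W a b
  proof -
    define y q where "y = W *\<^sub>v x" and "q = x \<bullet> y"
    have y: "y \<in> carrier_vec n" unfolding y_def using sym_matD(1)[OF W] x(1) by (rule mult_mat_vec_carrier)
    have psd: "sym_pos_semidef n W"
      unfolding sym_pos_semidef_iff
    proof (intro conjI ballI W)
      fix v :: "real vec" assume v: "v \<in> carrier_vec n"
      have "0 \<le> a * (v \<bullet> v)" using a real_scalar_prod_self_nonneg[of v] by simp
      then show "0 \<le> v \<bullet> (W *\<^sub>v v)" using bounds[OF v] by linarith
    qed
    have xx: "0 < x \<bullet> x" using real_scalar_prod_self_pos[OF x] .
    have q: "a * (x \<bullet> x) \<le> q" using bounds[OF x(1)] by (simp add: q_def y_def)
    with xx a have q0: "0 < q" using mult_pos_pos[of a "x \<bullet> x"] by linarith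
    have "a * q \<le> y \<bullet> y"
    proof -
      have "a * q * q = a * (x \<bullet> y)\<^sup>2" by (simp add: q_def power2_eq_square)
      also have "\<dots> \<le> a * ((x \<bullet> x) * (y \<bullet> y))"
        using real_Cauchy_Schwarz[OF x(1) y] a by simp
      also have "\<dots> \<le> q * (y \<bullet> y)"
        using q real_scalar_prod_self_nonneg[of y] by (simp add: mult.assoc[symmetric] mult_right_mono)
      finally show ?thesis using q0 by (simp add: mult.commute[of "a * q"])
    qed
    moreover have "y \<bullet> y \<le> b * q"
    proof (cases "y \<bullet> y = 0")
      case True
      have "0 \<le> b * (x \<bullet> x)" using bounds[OF x(1)] q q0 by (simp add: q_def y_def)
      then have "0 \<le> b" using xx by (simp add: zero_le_mult_iff)
      then show ?thesis using True q0 by simp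
    next
      case False
      then have yy: "0 < y \<bullet> y" using real_scalar_prod_self_nonneg[of y] by simp
      have "(y \<bullet> y)\<^sup>2 \<le> (y \<bullet> (W *\<^sub>v y)) * q"
        using form_Cauchy_Schwarz[OF psd y x(1)] by (simp add: q_def y_def)
      also have "\<dots> \<le> (b * (y \<bullet> y)) * q"
        using bounds[OF y] q0 by (simp add: mult_right_mono)
      finally show ?thesis using yy by (simp add: power2_eq_square mult_ac)
    qed
    ultimately have "(y \<bullet> y) / q \<in> {a..b}" using q0 by (simp add: pos_le_divide_eq pos_divide_le_eq)
    moreover have "(y \<bullet> y) / q * q = y \<bullet> y" using q0 by simp
    ultimately show ?thesis unfolding q_def y_def by blast
  qed
  consider "0 < l" | "u < 0" using 0 by fastforce
  then show ?thesis
  proof cases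
    case 1
    show ?thesis by (rule pos[OF Z 1 bounds])
  next
    case 2
    have Zc: "Z \<in> carrier_mat n n" by (rule sym_matD(1)[OF Z])
    have neg: "- Z *\<^sub>v v = - (Z *\<^sub>v v)" if "v \<in> carrier_vec n" for v
      using that Zc by (intro uminus_mult_mat_vec) auto
    have nZ: "sym_mat n (- Z)"
      unfolding sym_mat_def transpose_uminus using Zc sym_matD(2)[OF Z] by simp
    have nb: "- u * (v \<bullet> v) \<le> v \<bullet> (- Z *\<^sub>v v) \<and> v \<bullet> (- Z *\<^sub>v v) \<le> - l * (v \<bullet> v)"
      if "v \<in> carrier_vec n" for v
      using bounds[OF that] that Zc by (simp add: neg)
    have "0 < - u" using 2 by simp
    from pos[OF nZ this nb] obtain z where z: "z \<in> {- u..- l}"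
      "z * (x \<bullet> (- Z *\<^sub>v x)) = (- Z *\<^sub>v x) \<bullet> (- Z *\<^sub>v x)"
      by blast
    have "- z \<in> {l..u}" using z(1) by auto
    moreover have "- z * (x \<bullet> (Z *\<^sub>v x)) = (Z *\<^sub>v x) \<bullet> (Z *\<^sub>v x)"
      using z(2) Zc x(1) by (simp add: neg)
    ultimately show ?thesis by blast
  qed
qed

text \<open>
  \<open>U_poly\<close> with number \<open>j\<close> depends on the parameters with numbers below \<open>j\<close> only. Hence parameters
  that realise a ratio at one level can be extended to the next level.
\<close>

lemma U_poly_fun_upd:
  "j \<le> k \<Longrightarrow> U_poly (\<gamma>E(k := e)) (\<gamma>R(k := r)) j = U_poly \<gamma>E \<gamma>R j"
  by (induction \<gamma>E \<gamma>R j rule: U_poly.induct) auto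

lemma poly_U_poly_step:
  "poly (U_poly \<gamma>E \<gamma>R (Suc (Suc k))) t =
    (t + (-1) ^ Suc (Suc k) * \<gamma>E (Suc k)) * poly (U_poly \<gamma>E \<gamma>R (Suc k)) t
    - \<gamma>R (Suc k) * poly (U_poly \<gamma>E \<gamma>R k) t"
  by (simp add: algebra_simps)

text \<open>
  One step of the recursion for the ratios maps a product of intervals continuously to the reals, as long
  as the interval of the denominators avoids \<open>0\<close>. The image is compact and connected.
\<close>

lemma ratio_range_interval:
  fixes t \<sigma> l u :: real
  assumes 0: "0 \<notin> {l..u}" and ne: "a \<le> b" "c \<le> d" "l \<le> u"
  obtains l' u' where "l' \<le> u'"
    "(\<lambda>(e, r, z). t + \<sigma> * e - r / z) ` ({a..b} \<times> {c..d} \<times> {l..u}) = {l'..u'}"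
proof -
  let ?f = "\<lambda>(e, r, z). t + \<sigma> * e - r / z"
  let ?K = "{a..b} \<times> {c..d} \<times> {l..u}"
  have cont: "continuous_on ?K ?f"
    unfolding case_prod_unfold using 0 by (intro continuous_intros) auto
  have conn: "connected (?f ` ?K)"
    by (intro connected_continuous_image cont connected_Times connected_Icc)
  have comp: "compact (?f ` ?K)"
    by (intro compact_continuous_image cont compact_Times compact_Icc)
  have ne': "?f ` ?K \<noteq> {}" using ne by auto
  obtain l' where l': "l' \<in> ?f ` ?K" "\<forall>y \<in> ?f ` ?K. l' \<le> y"
    using compact_attains_inf[OF comp ne'] by blast
  obtain u' where u': "u' \<in> ?f ` ?K" "\<forall>y \<in> ?f ` ?K. y \<le> u'"
    using compact_attains_sup[OF comp ne'] by blast
  have "?f ` ?K = {l'..u'}"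
  proof (intro equalityI subsetI)
    fix y assume "y \<in> ?f ` ?K"
    then have "l' \<le> y \<and> y \<le> u'" using l'(2) u'(2) by blast
    then show "y \<in> {l'..u'}" by simp
  next
    fix y assume "y \<in> {l'..u'}"
    then have "l' \<le> y" "y \<le> u'" by simp_all
    then show "y \<in> ?f ` ?K" by (rule connectedD_interval[OF conn l'(1) u'(1)])
  qed
  moreover have "l' \<le> u'" using l'(2) u'(1) by blast
  ultimately show ?thesis using that by blast
qed

lemma vec_add_diff_cancel_left:
  "e \<in> carrier_vec m \<Longrightarrow> c \<in> carrier_vec m \<Longrightarrow> e + c - e = (c :: real vec)"
  by (intro eq_vecI) auto

lemma vec_solve_last_summand:
  assumes "e \<in> carrier_vec m" "r \<in> carrier_vec m" "c \<in> carrier_vec m"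
    and "a = p \<cdot>\<^sub>v e + r + (c :: real vec)"
  shows "a + (- p) \<cdot>\<^sub>v e - r = c"
  using assms by (intro eq_vecI) auto

context
  fixes N :: nat and n :: "nat \<Rightarrow> nat" and A B S :: "nat \<Rightarrow> real mat"
  assumes n: "k \<le> N \<Longrightarrow> 0 < n k"
    and E: "k \<le> N \<Longrightarrow> sym_mat (n k) (E_mat A S k)"
    and R: "k \<in> {1..N} \<Longrightarrow> R_mat B S k \<in> carrier_mat (n k) (n (k - 1))"
begin

abbreviation (input) "E' k \<equiv> E_mat A S k"
abbreviation (input) "R' k \<equiv> R_mat B S k"
abbreviation (input) "RR k \<equiv> R' k * transpose_mat (R' k)"
abbreviation (input) "aE k \<equiv> Min (spectrum (E' k))"
abbreviation (input) "bE k \<equiv> Max (spectrum (E' k))"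
abbreviation (input) "aR k \<equiv> Min (spectrum (RR k))"
abbreviation (input) "bR k \<equiv> Max (spectrum (RR k))"

lemma RR_form:
  assumes k: "k \<in> {1..N}" and v: "v \<in> carrier_vec (n k)"
  shows "v \<bullet> (RR k *\<^sub>v v) = (transpose_mat (R' k) *\<^sub>v v) \<bullet> (transpose_mat (R' k) *\<^sub>v v)"
proof -
  have Rt: "transpose_mat (R' k) \<in> carrier_mat (n (k - 1)) (n k)" using R[OF k] by simp
  have one: "R' k * 1\<^sub>m (n (k - 1)) = R' k" using R[OF k] by simp
  show ?thesis
    using form_congruence[OF R[OF k] one_carrier_mat v, unfolded one] mult_mat_vec_carrier[OF Rt v]
    by simp
qed

lemma RR_sym:
  assumes k: "k \<in> {1..N}"
  shows "sym_mat (n k) (RR k)"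
proof -
  have one: "R' k * 1\<^sub>m (n (k - 1)) = R' k" using R[OF k] by simp
  have "sym_mat (n (k - 1)) (1\<^sub>m (n (k - 1)))" by (simp add: sym_mat_def)
  from sym_mat_congruence[OF R[OF k] this, unfolded one] show ?thesis .
qed

lemma min_le_max:
  "k \<le> N \<Longrightarrow> aE k \<le> bE k" "k \<in> {1..N} \<Longrightarrow> aR k \<le> bR k"
proof -
  show "aE k \<le> bE k" if "k \<le> N"
    using spectrum_sym_bounds(1,2)[OF E[OF that] n[OF that]] by (intro Max_ge Min_in)
  show "aR k \<le> bR k" if "k \<in> {1..N}"
    using spectrum_sym_bounds(1,2)[OF RR_sym[OF that]] n[of k] that by (intro Max_ge Min_in) auto
qed

lemma E_rayleigh:
  assumes "k \<le> N" "v \<in> carrier_vec (n k)" "v \<noteq> 0\<^sub>v (n k)"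
  shows "v \<bullet> (E' k *\<^sub>v v) / (v \<bullet> v) \<in> {aE k..bE k}"
  using spectrum_sym_bounds(3,4)[OF E[OF assms(1)] n[OF assms(1)] assms(2)]
    real_scalar_prod_self_pos[OF assms(2,3)]
  by (simp add: pos_le_divide_eq pos_divide_le_eq)

lemma R_rayleigh:
  assumes k: "k \<in> {1..N}" and v: "v \<in> carrier_vec (n k)" "v \<noteq> 0\<^sub>v (n k)"
  shows "(transpose_mat (R' k) *\<^sub>v v) \<bullet> (transpose_mat (R' k) *\<^sub>v v) / (v \<bullet> v) \<in> {aR k..bR k}"
proof -
  have "0 < n k" using n k by simp
  from spectrum_sym_bounds(3,4)[OF RR_sym[OF k] this v(1)]
  show ?thesis
    using real_scalar_prod_self_pos[OF v] by (simp add: pos_le_divide_eq pos_divide_le_eq RR_form[OF k v(1)])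
qed

lemma admissible_exists: "\<exists>\<gamma>E \<gamma>R. admissible N A B S \<gamma>E \<gamma>R"
  using min_le_max by (intro exI[of _ "aE"] exI[of _ "aR"]) (auto simp: admissible_def)

text \<open>
  The recursion of the polynomials starts with \<open>\<gamma>R 1\<close>, hence the exception for \<open>k = 0\<close>.
\<close>

lemma admissible_fun_upd:
  assumes "admissible N A B S \<gamma>E \<gamma>R" "e \<in> {aE k..bE k}" "k = 0 \<or> r \<in> {aR k..bR k}"
  shows "admissible N A B S (\<gamma>E(k := e)) (\<gamma>R(k := r))"
  using assms by (auto simp: admissible_def)

text \<open>
  The invariant of the block elimination. The matrix \<open>Z\<close> is the pivot, \<open>{l..u}\<close> contains its
  Rayleigh quotients, every \<open>z\<close> in \<open>{l..u}\<close> is a ratio of consecutive polynomials at \<open>t\<close> for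
  admissible parameters, and the last conjunct is the recurrence after elimination of the earlier
  blocks. The bounds \<open>l\<close> and \<open>u\<close> need to be attained by the ratios, and all points between
  them as well: if \<open>0\<close> were among these points, \<open>t\<close> would be a root. This is how the absence of roots
  yields definiteness of the pivot, and with it the invertibility needed for the next one.
\<close>

lemma block_elimination:
  assumes x: "\<And>k. k \<le> N \<Longrightarrow> x k \<in> carrier_vec (n k)"
    and rec: "\<And>k. k \<le> N \<Longrightarrow> t \<cdot>\<^sub>v x k =
      (-1) ^ k \<cdot>\<^sub>v (E' k *\<^sub>v x k)
      + (if 0 < k then R' k *\<^sub>v x (k - 1) else 0\<^sub>v (n k))
      + (if k < N then transpose_mat (R' (Suc k)) *\<^sub>v x (Suc k) else 0\<^sub>v (n k))"
    and no_root: "\<And>k. k \<le> N \<Longrightarrow> t \<notin> root_set N A B S (Suc k)"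
    and k: "k \<le> N"
  shows "\<exists>Z l u. sym_mat (n k) Z \<and> l \<le> u \<and> 0 \<notin> {l..u} \<and>
    (\<forall>v \<in> carrier_vec (n k). l * (v \<bullet> v) \<le> v \<bullet> (Z *\<^sub>v v) \<and> v \<bullet> (Z *\<^sub>v v) \<le> u * (v \<bullet> v)) \<and>
    (\<forall>z \<in> {l..u}. \<exists>\<gamma>E \<gamma>R. admissible N A B S \<gamma>E \<gamma>R \<and>
      poly (U_poly \<gamma>E \<gamma>R (Suc k)) t = z * poly (U_poly \<gamma>E \<gamma>R k) t) \<and>
    Z *\<^sub>v x k = (if k < N then transpose_mat (R' (Suc k)) *\<^sub>v x (Suc k) else 0\<^sub>v (n k))"
  using k
proof (induction k)
  case 0
  let ?c = "if 0 < N then transpose_mat (R' (Suc 0)) *\<^sub>v x (Suc 0) else 0\<^sub>v (n 0)"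
  have Ec: "E' 0 \<in> carrier_mat (n 0) (n 0)" by (rule sym_matD(1)[OF E]) simp
  have x0: "x 0 \<in> carrier_vec (n 0)" by (rule x) simp
  have cc: "?c \<in> carrier_vec (n 0)"
    using R[of "Suc 0"] x[of "Suc 0"] by (auto intro: mult_mat_vec_carrier)
  define Z where "Z = t \<cdot>\<^sub>m 1\<^sub>m (n 0) - E' 0"
  have Zv: "Z *\<^sub>v v = t \<cdot>\<^sub>v v - E' 0 *\<^sub>v v" if "v \<in> carrier_vec (n 0)" for v
    unfolding Z_def using that Ec
    by (simp add: minus_mult_distrib_mat_vec[of _ "n 0" "n 0"] smult_mat_mult_vec[of _ "n 0" "n 0"])
  have form: "v \<bullet> (Z *\<^sub>v v) = t * (v \<bullet> v) - v \<bullet> (E' 0 *\<^sub>v v)" if v: "v \<in> carrier_vec (n 0)" for v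
    using v mult_mat_vec_carrier[OF Ec v] by (simp add: Zv scalar_prod_minus_distrib[of _ "n 0"])
  have sym: "sym_mat (n 0) Z"
  proof -
    have "transpose_mat Z = transpose_mat (t \<cdot>\<^sub>m 1\<^sub>m (n 0)) - transpose_mat (E' 0)"
      unfolding Z_def using Ec by (intro transpose_minus) auto
    moreover have "transpose_mat (t \<cdot>\<^sub>m 1\<^sub>m (n 0)) = t \<cdot>\<^sub>m 1\<^sub>m (n 0)" by (rule eq_matI) auto
    moreover have "transpose_mat (E' 0) = E' 0" by (rule sym_matD(2)[OF E]) simp
    ultimately have "transpose_mat Z = Z" unfolding Z_def by (simp only:)
    moreover have "Z \<in> carrier_mat (n 0) (n 0)" unfolding Z_def using Ec by (rule minus_carrier_mat)
    ultimately show ?thesis unfolding sym_mat_def by blast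
  qed
  have le: "t - bE 0 \<le> t - aE 0" using min_le_max(1)[of 0] by simp
  have attained: "\<exists>\<gamma>E \<gamma>R. admissible N A B S \<gamma>E \<gamma>R \<and>
        poly (U_poly \<gamma>E \<gamma>R (Suc 0)) t = z * poly (U_poly \<gamma>E \<gamma>R 0) t"
      if z: "z \<in> {t - bE 0..t - aE 0}" for z
    proof -
      obtain \<gamma>E \<gamma>R where "admissible N A B S \<gamma>E \<gamma>R" using admissible_exists by blast
      \<comment> \<open>\<open>U\<^sub>1(t) / U\<^sub>0(t) = t - \<gamma>E 0\<close>, so \<open>\<gamma>E 0 = t - z\<close> realises \<open>z\<close>.\<close>
      then have "admissible N A B S (\<gamma>E(0 := t - z)) (\<gamma>R(0 := 0))"
        using z by (intro admissible_fun_upd) auto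
      then show ?thesis
        by (intro exI[of _ "\<gamma>E(0 := t - z)"] exI[of _ "\<gamma>R(0 := 0)"] conjI) simp_all
    qed
  have not0: "0 \<notin> {t - bE 0..t - aE 0}"
  proof
    assume "0 \<in> {t - bE 0..t - aE 0}"
    from attained[OF this] show False using no_root[of 0] unfolding root_set_def by auto
  qed
  have bounds: "(t - bE 0) * (v \<bullet> v) \<le> v \<bullet> (Z *\<^sub>v v) \<and> v \<bullet> (Z *\<^sub>v v) \<le> (t - aE 0) * (v \<bullet> v)"
    if v: "v \<in> carrier_vec (n 0)" for v
    using spectrum_sym_bounds(3,4)[OF E n v] by (simp add: form[OF v] algebra_simps)
  have pivot: "Z *\<^sub>v x 0 = ?c"
  proof -
    have "t \<cdot>\<^sub>v x 0 = E' 0 *\<^sub>v x 0 + ?c"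
      using rec[of 0] mult_mat_vec_carrier[OF Ec x0] cc by simp
    then show ?thesis
      unfolding Zv[OF x0] using vec_add_diff_cancel_left[OF mult_mat_vec_carrier[OF Ec x0] cc] by simp
  qed
  show ?case
    using sym le not0 bounds attained pivot by blast
next
  case (Suc k)
  let ?K = "Suc k"
  let ?c = "if ?K < N then transpose_mat (R' (Suc ?K)) *\<^sub>v x (Suc ?K) else 0\<^sub>v (n ?K)"
  \<comment> \<open>The sign of \<open>\<gamma>E ?K\<close> in the recursion of the polynomials, opposite to that of \<open>E' ?K\<close> in the
    recurrence of the blocks, since the latter moves to the other side.\<close>
  define \<sigma> where "\<sigma> = (-1 :: real) ^ Suc ?K"
  have kN: "?K \<le> N" "?K \<in> {1..N}" using Suc.prems by auto
  from Suc obtain Z l u where Z: "sym_mat (n k) Z" and lu: "l \<le> u" "0 \<notin> {l..u}"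
    and bounds: "\<And>v. v \<in> carrier_vec (n k) \<Longrightarrow> l * (v \<bullet> v) \<le> v \<bullet> (Z *\<^sub>v v) \<and> v \<bullet> (Z *\<^sub>v v) \<le> u * (v \<bullet> v)"
    and attained: "\<And>z. z \<in> {l..u} \<Longrightarrow> \<exists>\<gamma>E \<gamma>R. admissible N A B S \<gamma>E \<gamma>R \<and>
      poly (U_poly \<gamma>E \<gamma>R (Suc k)) t = z * poly (U_poly \<gamma>E \<gamma>R k) t"
    and Zx: "Z *\<^sub>v x k = transpose_mat (R' ?K) *\<^sub>v x ?K"
    by auto
  have Zc: "Z \<in> carrier_mat (n k) (n k)" by (rule sym_matD(1)[OF Z])
  have Ec: "E' ?K \<in> carrier_mat (n ?K) (n ?K)" by (rule sym_matD(1)[OF E[OF kN(1)]])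
  have Rc: "R' ?K \<in> carrier_mat (n ?K) (n k)" using R[OF kN(2)] by simp
  have Rt: "transpose_mat (R' ?K) \<in> carrier_mat (n k) (n ?K)" using Rc by simp
  have xk: "x k \<in> carrier_vec (n k)" and xK: "x ?K \<in> carrier_vec (n ?K)" using x kN by auto
  have cc: "?c \<in> carrier_vec (n ?K)"
    using R[of "Suc ?K"] x[of "Suc ?K"] by (auto intro: mult_mat_vec_carrier)
  \<comment> \<open>\<open>l\<close> and \<open>u\<close> have the same sign, so the form of \<open>Z\<close> vanishes at \<open>0\<close> only.\<close>
  have Z_inj: "v = 0\<^sub>v (n k)" if v: "v \<in> carrier_vec (n k)" "Z *\<^sub>v v = 0\<^sub>v (n k)" for v
  proof -
    have "l * (v \<bullet> v) \<le> 0" "0 \<le> u * (v \<bullet> v)" using bounds[OF v(1)] v by auto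
    then have "\<not> 0 < v \<bullet> v" using lu by (auto simp: mult_le_0_iff zero_le_mult_iff)
    then show ?thesis using real_scalar_prod_self_pos[OF v(1)] by blast
  qed
  define W where "W = mat_inv Z"
  note W = mat_inv_props[OF Zc Z_inj, folded W_def]
  have Ws: "sym_mat (n k) W" by (rule sym_mat_inv[OF Z W])
  have ZW: "Z *\<^sub>v (W *\<^sub>v v) = v" and WZ: "W *\<^sub>v (Z *\<^sub>v v) = v" if "v \<in> carrier_vec (n k)" for v
    using assoc_mult_mat_vec[OF Zc W(1) that] assoc_mult_mat_vec[OF W(1) Zc that] W(2,3) that by auto
  define Y where "Y = R' ?K * W * transpose_mat (R' ?K)"
  have Ys: "sym_mat (n ?K) Y" unfolding Y_def by (rule sym_mat_congruence[OF Rc Ws])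
  have Yc: "Y \<in> carrier_mat (n ?K) (n ?K)" by (rule sym_matD(1)[OF Ys])
  define X where "X = (t \<cdot>\<^sub>m 1\<^sub>m (n ?K) + \<sigma> \<cdot>\<^sub>m E' ?K) - Y"
  have Xv: "X *\<^sub>v v = t \<cdot>\<^sub>v v + \<sigma> \<cdot>\<^sub>v (E' ?K *\<^sub>v v) - Y *\<^sub>v v" if "v \<in> carrier_vec (n ?K)" for v
    unfolding X_def using that Ec Yc
    by (simp add: minus_mult_distrib_mat_vec[of _ "n ?K" "n ?K"] add_mult_distrib_mat_vec[of _ "n ?K" "n ?K"]
        smult_mat_mult_vec[of _ "n ?K" "n ?K"])
  obtain l' u' where lu': "l' \<le> u'" and
    range: "(\<lambda>(e, r, z). t + \<sigma> * e - r / z) ` ({aE ?K..bE ?K} \<times> {aR ?K..bR ?K} \<times> {l..u}) = {l'..u'}"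
    by (rule ratio_range_interval[OF lu(2) min_le_max(1)[OF kN(1)] min_le_max(2)[OF kN(2)] lu(1)])
  have Xc: "X \<in> carrier_mat (n ?K) (n ?K)" unfolding X_def using Yc by (rule minus_carrier_mat)
  have sym: "sym_mat (n ?K) X"
  proof -
    have "transpose_mat X = transpose_mat (t \<cdot>\<^sub>m 1\<^sub>m (n ?K) + \<sigma> \<cdot>\<^sub>m E' ?K) - transpose_mat Y"
      unfolding X_def using Ec Yc by (intro transpose_minus) auto
    also have "transpose_mat (t \<cdot>\<^sub>m 1\<^sub>m (n ?K) + \<sigma> \<cdot>\<^sub>m E' ?K) =
        transpose_mat (t \<cdot>\<^sub>m 1\<^sub>m (n ?K)) + transpose_mat (\<sigma> \<cdot>\<^sub>m E' ?K)"
      using Ec by (intro transpose_add) auto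
    also have "transpose_mat (t \<cdot>\<^sub>m 1\<^sub>m (n ?K)) = t \<cdot>\<^sub>m 1\<^sub>m (n ?K)" by (rule eq_matI) auto
    also have "transpose_mat (\<sigma> \<cdot>\<^sub>m E' ?K) = \<sigma> \<cdot>\<^sub>m transpose_mat (E' ?K)" by (rule eq_matI) auto
    also have "transpose_mat (E' ?K) = E' ?K" by (rule sym_matD(2)[OF E[OF kN(1)]])
    also have "transpose_mat Y = Y" by (rule sym_matD(2)[OF Ys])
    finally have Xt: "transpose_mat X = X" unfolding X_def .
    show ?thesis unfolding sym_mat_def by (rule conjI[OF Xc Xt])
  qed
  have attained': "\<exists>\<gamma>E \<gamma>R. admissible N A B S \<gamma>E \<gamma>R \<and>
        poly (U_poly \<gamma>E \<gamma>R (Suc ?K)) t = z' * poly (U_poly \<gamma>E \<gamma>R ?K) t"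
      if z': "z' \<in> {l'..u'}" for z'
    proof -
      from z' obtain e r z where erz: "e \<in> {aE ?K..bE ?K}" "r \<in> {aR ?K..bR ?K}" "z \<in> {l..u}"
        "z' = t + \<sigma> * e - r / z"
        unfolding range[symmetric] by auto
      obtain \<gamma>E \<gamma>R where g: "admissible N A B S \<gamma>E \<gamma>R"
        "poly (U_poly \<gamma>E \<gamma>R ?K) t = z * poly (U_poly \<gamma>E \<gamma>R k) t"
        using attained[OF erz(3)] by blast
      let ?gE = "\<gamma>E(?K := e)" and ?gR = "\<gamma>R(?K := r)"
      have "z \<noteq> 0" using erz(3) lu(2) by auto
      have "poly (U_poly ?gE ?gR (Suc ?K)) t =
          (t + \<sigma> * e) * poly (U_poly \<gamma>E \<gamma>R ?K) t - r * poly (U_poly \<gamma>E \<gamma>R k) t"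
        unfolding poly_U_poly_step \<sigma>_def by (simp only: U_poly_fun_upd fun_upd_same order_refl le_SucI)
      also have "r * poly (U_poly \<gamma>E \<gamma>R k) t = r / z * poly (U_poly \<gamma>E \<gamma>R ?K) t"
        using \<open>z \<noteq> 0\<close> by (simp add: g(2))
      finally have "poly (U_poly ?gE ?gR (Suc ?K)) t = z' * poly (U_poly ?gE ?gR ?K) t"
        by (simp only: U_poly_fun_upd order_refl erz(4)) (simp only: algebra_simps)
      moreover have "admissible N A B S ?gE ?gR"
        using g(1) erz by (intro admissible_fun_upd) auto
      ultimately show ?thesis by blast
    qed
  have not0: "0 \<notin> {l'..u'}"
    proof
      assume "0 \<in> {l'..u'}"
      from attained'[OF this] show False using no_root[OF kN(1)] unfolding root_set_def by auto
    qed
  have bounds': "l' * (v \<bullet> v) \<le> v \<bullet> (X *\<^sub>v v) \<and> v \<bullet> (X *\<^sub>v v) \<le> u' * (v \<bullet> v)"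
    if v: "v \<in> carrier_vec (n ?K)" for v
  proof -
    define y where "y = transpose_mat (R' ?K) *\<^sub>v v"
    have y: "y \<in> carrier_vec (n k)" unfolding y_def by (rule mult_mat_vec_carrier[OF Rt v])
    have form: "v \<bullet> (X *\<^sub>v v) = t * (v \<bullet> v) + \<sigma> * (v \<bullet> (E' ?K *\<^sub>v v)) - y \<bullet> (W *\<^sub>v y)"
      using v mult_mat_vec_carrier[OF Ec v] mult_mat_vec_carrier[OF Yc v]
        form_congruence[OF Rc W(1) v]
      by (simp add: Xv scalar_prod_minus_distrib[of _ "n ?K"] scalar_prod_add_distrib[of _ "n ?K"] Y_def y_def)
    show ?thesis
    proof (cases "v = 0\<^sub>v (n ?K)")
      case True
      then show ?thesis using mult_mat_vec_carrier[OF Xc v] by simp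
    next
      case False
      have vv: "0 < v \<bullet> v" by (rule real_scalar_prod_self_pos[OF v False])
      define e r where "e = v \<bullet> (E' ?K *\<^sub>v v) / (v \<bullet> v)" and "r = y \<bullet> y / (v \<bullet> v)"
      have er: "e \<in> {aE ?K..bE ?K}" "r \<in> {aR ?K..bR ?K}"
        using E_rayleigh[OF kN(1) v False] R_rayleigh[OF kN(2) v False] by (simp_all only: e_def r_def y_def)
      obtain z where z: "z \<in> {l..u}" "z * (y \<bullet> (W *\<^sub>v y)) = y \<bullet> y"
      proof (cases "W *\<^sub>v y = 0\<^sub>v (n k)")
        case True
        \<comment> \<open>\<open>y = 0\<close> leaves \<open>z\<close> free; the parameter \<open>r\<close> is \<open>0\<close>.\<close>
        then have "y = 0\<^sub>v (n k)" using ZW[OF y] Zc by auto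
        then show ?thesis using that[of l] lu(1) True by simp
      next
        case False
        have "(W *\<^sub>v y) \<bullet> y = y \<bullet> (W *\<^sub>v y)"
          by (rule comm_scalar_prod[OF mult_mat_vec_carrier[OF W(1) y] y])
        moreover obtain z where "z \<in> {l..u}" "z * ((W *\<^sub>v y) \<bullet> y) = y \<bullet> y"
          using inverse_form_ratio[OF Z lu(2) bounds mult_mat_vec_carrier[OF W(1) y] False]
          unfolding ZW[OF y] by blast
        ultimately show ?thesis using that[of z] by simp
      qed
      have "z \<noteq> 0" using z(1) lu(2) by auto
      then have "v \<bullet> (X *\<^sub>v v) = (t + \<sigma> * e - r / z) * (v \<bullet> v)"
        using vv z(2) by (simp add: form e_def r_def field_simps)
      moreover have "t + \<sigma> * e - r / z \<in> {l'..u'}"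
        unfolding range[symmetric] using er z(1) by (intro image_eqI[of _ _ "(e, r, z)"]) auto
      ultimately show ?thesis using vv by (simp add: mult_right_mono)
    qed
  qed
  have pivot: "X *\<^sub>v x ?K = ?c"
  proof -
    have Yx: "Y *\<^sub>v x ?K = R' ?K *\<^sub>v x k"
    proof -
      have "Y *\<^sub>v x ?K = R' ?K *\<^sub>v (W *\<^sub>v (transpose_mat (R' ?K) *\<^sub>v x ?K))"
        unfolding Y_def by (rule mult3_mat_vec[OF Rc W(1) Rt xK])
      also have "transpose_mat (R' ?K) *\<^sub>v x ?K = Z *\<^sub>v x k" by (rule Zx[symmetric])
      also have "W *\<^sub>v (Z *\<^sub>v x k) = x k" by (rule WZ[OF xk])
      finally show ?thesis .
    qed
    have sig: "\<sigma> = - ((-1) ^ ?K)" by (simp add: \<sigma>_def)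
    have "t \<cdot>\<^sub>v x ?K = (-1) ^ ?K \<cdot>\<^sub>v (E' ?K *\<^sub>v x ?K) + R' ?K *\<^sub>v x k + ?c"
      using rec[OF kN(1)] by simp
    then show ?thesis
      unfolding Xv[OF xK] Yx sig
      by (rule vec_solve_last_summand[OF mult_mat_vec_carrier[OF Ec xK] mult_mat_vec_carrier[OF Rc xk] cc])
  qed
  show ?case
    using sym lu' not0 bounds' attained' pivot by blast
qed

text \<open>
  If \<open>t\<close> were no root, all pivots would be definite, and solving the eliminated recurrence
  backwards from the last block would give only zero blocks.
\<close>

lemma eigenvalue_is_root:
  assumes x: "\<And>k. k \<le> N \<Longrightarrow> x k \<in> carrier_vec (n k)"
    and rec: "\<And>k. k \<le> N \<Longrightarrow> t \<cdot>\<^sub>v x k =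
      (-1) ^ k \<cdot>\<^sub>v (E' k *\<^sub>v x k)
      + (if 0 < k then R' k *\<^sub>v x (k - 1) else 0\<^sub>v (n k))
      + (if k < N then transpose_mat (R' (Suc k)) *\<^sub>v x (Suc k) else 0\<^sub>v (n k))"
    and nz: "\<exists>k\<le>N. x k \<noteq> 0\<^sub>v (n k)"
  shows "\<exists>k\<le>N. t \<in> root_set N A B S (Suc k)"
proof (rule ccontr)
  assume "\<not> ?thesis"
  then have no_root: "\<And>k. k \<le> N \<Longrightarrow> t \<notin> root_set N A B S (Suc k)" by blast
  have zero: "x k = 0\<^sub>v (n k)"
    if k: "k \<le> N" and c: "(if k < N then transpose_mat (R' (Suc k)) *\<^sub>v x (Suc k) else 0\<^sub>v (n k)) = 0\<^sub>v (n k)" for k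
  proof -
    from block_elimination[OF x rec no_root k] obtain Z l u where lu: "0 \<notin> {l..u}"
      and bounds: "l * (x k \<bullet> x k) \<le> x k \<bullet> (Z *\<^sub>v x k)" "x k \<bullet> (Z *\<^sub>v x k) \<le> u * (x k \<bullet> x k)"
      and Zx: "Z *\<^sub>v x k = 0\<^sub>v (n k)"
      using x[OF k] unfolding c by blast
    have "l * (x k \<bullet> x k) \<le> 0" "0 \<le> u * (x k \<bullet> x k)" using bounds x[OF k] by (auto simp: Zx)
    then have "\<not> 0 < x k \<bullet> x k" using lu by (auto simp: mult_le_0_iff zero_le_mult_iff)
    then show ?thesis using real_scalar_prod_self_pos[OF x[OF k]] by blast
  qed
  have "x k = 0\<^sub>v (n k)" if "k \<le> N" for k
    using that
  proof (induction k rule: inc_induct)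
    case base
    show ?case by (rule zero) auto
  next
    case (step k)
    have "R' (Suc k) \<in> carrier_mat (n (Suc k)) (n k)" using R[of "Suc k"] step by simp
    then have "transpose_mat (R' (Suc k)) *\<^sub>v 0\<^sub>v (n (Suc k)) = 0\<^sub>v (n k)"
      by (intro eq_vecI) auto
    then show ?case using step by (intro zero) auto
  qed
  then show False using nz by blast
qed

end

section \<open>Zero is not a root\<close>

text \<open>
  A vector \<open>v\<close> in the kernel of the transpose is orthogonal to all columns of \<open>B\<close>. These span
  the whole space because the rank equals the number of rows, so \<open>v\<close> is orthogonal to itself.
\<close>

lemma full_rank_transpose_inj:
  assumes B: "B \<in> carrier_mat m k" and mk: "m \<le> k" and rank: "full_rank B"
    and v: "v \<in> carrier_vec m" and 0: "transpose_mat B *\<^sub>v v = 0\<^sub>v k"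
  shows "v = 0\<^sub>v m"
proof -
  interpret vec_space "TYPE(real)" m .
  have cols: "set (cols B) \<subseteq> carrier_vec m" using B cols_dim by blast
  have rank_m: "rank B = m" using rank B mk by (simp add: full_rank_def)
  have "\<exists>T. finite T \<and> maximal T (\<lambda>T. T \<subseteq> set (cols B) \<and> lin_indpt T) \<and> {} \<subseteq> T"
  proof (rule maximal_exists_superset[of "set (cols B)"])
    show "{} \<subseteq> set (cols B) \<and> lin_indpt {}" by (simp add: lin_dep_def)
  qed auto
  then obtain T where T: "finite T" "maximal T (\<lambda>T. T \<subseteq> set (cols B) \<and> lin_indpt T)" by blast
  then have Tc: "T \<subseteq> set (cols B)" and Ti: "lin_indpt T" by (auto simp: maximal_def)
  have "card T = m" using rank_card_indpt[OF B T(2)] rank_m by simp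
  then have "basis T"
    using dim_li_is_basis[OF fin_dim T(1) _ Ti] Tc cols by (simp add: dim_is_n)
  then have "span T = carrier_vec m" by (simp add: basis_def)
  moreover have "span T \<subseteq> {u \<in> carrier_vec m. u \<bullet> v = 0}"
  proof (rule span_is_subset)
    show "submodule class_ring {u \<in> carrier_vec m. u \<bullet> v = 0} V"
      using v
      by (unfold_locales)
         (auto simp: module_vec_simps class_ring_simps add_scalar_prod_distrib[of _ m])
    show "T \<subseteq> {u \<in> carrier_vec m. u \<bullet> v = 0}"
    proof
      fix u assume "u \<in> T"
      then obtain j where j: "j < k" "u = col B j"
        using Tc B by (auto simp: cols_def)
      have "u \<bullet> v = (transpose_mat B *\<^sub>v v) $ j" using j B by simp
      then show "u \<in> {u \<in> carrier_vec m. u \<bullet> v = 0}" using j B by (simp add: 0)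
    qed
  qed
  ultimately have "v \<bullet> v = 0" using v by blast
  then show ?thesis using real_scalar_prod_self_eq_0_iff[OF v] by simp
qed

text \<open>
  Multiplying the recursion at \<open>0\<close> by \<open>U\<^sub>k\<^sub>+\<^sub>1(0)\<close> expresses the product of two consecutive values by a
  square and by the preceding product, and with the alternating sign both contributions are
  nonnegative, the second one positive.
\<close>

lemma U_poly_at_0:
  assumes "0 < \<gamma>E 0" "\<And>j. j \<in> {1..k} \<Longrightarrow> 0 \<le> \<gamma>E j" "\<And>j. j \<in> {1..k} \<Longrightarrow> 0 < \<gamma>R j"
  shows "0 < (-1) ^ Suc k * (poly (U_poly \<gamma>E \<gamma>R (Suc k)) 0 * poly (U_poly \<gamma>E \<gamma>R k) (0 :: real))"
  using assms
proof (induction k)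
  case (Suc k)
  define a b where "a = poly (U_poly \<gamma>E \<gamma>R (Suc k)) 0" and "b = poly (U_poly \<gamma>E \<gamma>R k) 0"
  have IH: "0 < (-1) ^ Suc k * (a * b)" using Suc by (simp add: a_def b_def)
  then have "a \<noteq> 0" by auto
  define c u where "c = (-1 :: real) ^ Suc k" and "u = poly (U_poly \<gamma>E \<gamma>R (Suc (Suc k))) 0"
  have c: "c * c = 1" by (simp add: c_def flip: power_mult_distrib)
  have u: "u = - c * \<gamma>E (Suc k) * a - \<gamma>R (Suc k) * b"
    unfolding u_def poly_U_poly_step a_def b_def c_def by simp
  have "0 < \<gamma>E (Suc k) * (a * a) + \<gamma>R (Suc k) * (c * (a * b))"
  proof (rule add_nonneg_pos)
    show "0 \<le> \<gamma>E (Suc k) * (a * a)" using Suc.prems(2)[of "Suc k"] by simp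
    show "0 < \<gamma>R (Suc k) * (c * (a * b))"
    proof (rule mult_pos_pos)
      show "0 < \<gamma>R (Suc k)" using Suc.prems(3)[of "Suc k"] by simp
      show "0 < c * (a * b)" using IH by (simp only: c_def)
    qed
  qed
  also have "\<dots> = (c * c) * \<gamma>E (Suc k) * (a * a) + \<gamma>R (Suc k) * (c * (a * b))" by (simp add: c)
  also have "\<dots> = - c * (u * a)" unfolding u by (simp add: algebra_simps)
  finally show ?case by (simp add: c_def u_def a_def)
qed simp

lemma spectrum_nonneg:
  assumes "sym_pos_semidef m X" "e \<in> spectrum X"
  shows "0 \<le> e"
proof -
  have X: "X \<in> carrier_mat m m" using assms(1) by (simp only: sym_pos_semidef_def)
  obtain v where v: "v \<in> carrier_vec m" "v \<noteq> 0\<^sub>v m" "X *\<^sub>v v = e \<cdot>\<^sub>v v"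
    using assms(2) X by (auto simp: spectrum_def eigenvalue_def eigenvector_def)
  have "0 \<le> v \<bullet> (X *\<^sub>v v)" using assms(1) v(1) unfolding sym_pos_semidef_def by blast
  then show ?thesis
    using v real_scalar_prod_self_pos[OF v(1,2)] by (simp add: zero_le_mult_iff)
qed

lemma spectrum_pos:
  assumes "sym_pos_def m X" "e \<in> spectrum X"
  shows "0 < e"
proof -
  have X: "X \<in> carrier_mat m m" using assms(1) by (simp only: sym_pos_def_def)
  obtain v where v: "v \<in> carrier_vec m" "v \<noteq> 0\<^sub>v m" "X *\<^sub>v v = e \<cdot>\<^sub>v v"
    using assms(2) X by (auto simp: spectrum_def eigenvalue_def eigenvector_def)
  have "0 < v \<bullet> (X *\<^sub>v v)" using assms(1) v(1,2) unfolding sym_pos_def_def by blast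
  then show ?thesis
    using v real_scalar_prod_self_pos[OF v(1,2)] by (simp add: zero_less_mult_iff)
qed

lemma zero_notin_root_set:
  assumes E0: "\<And>e. e \<in> spectrum (E_mat A S 0) \<Longrightarrow> 0 < e"
    and E: "\<And>k e. k \<le> N \<Longrightarrow> e \<in> spectrum (E_mat A S k) \<Longrightarrow> 0 \<le> e"
    and R: "\<And>k e. k \<in> {1..N} \<Longrightarrow>
      e \<in> spectrum (R_mat B S k * transpose_mat (R_mat B S k)) \<Longrightarrow> 0 < e"
    and Efin: "\<And>k. k \<le> N \<Longrightarrow> finite (spectrum (E_mat A S k)) \<and> spectrum (E_mat A S k) \<noteq> {}"
    and Rfin: "\<And>k. k \<in> {1..N} \<Longrightarrow> finite (spectrum (R_mat B S k * transpose_mat (R_mat B S k))) \<and>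
      spectrum (R_mat B S k * transpose_mat (R_mat B S k)) \<noteq> {}"
    and k: "k \<le> N"
  shows "0 \<notin> root_set N A B S (Suc k)"
proof
  assume "0 \<in> root_set N A B S (Suc k)"
  then obtain \<gamma>E \<gamma>R where g: "admissible N A B S \<gamma>E \<gamma>R" "poly (U_poly \<gamma>E \<gamma>R (Suc k)) 0 = 0"
    unfolding root_set_def by blast
  have gE: "Min (spectrum (E_mat A S j)) \<le> \<gamma>E j" if "j \<le> N" for j
    using g(1) that by (auto simp: admissible_def)
  have gR: "Min (spectrum (R_mat B S j * transpose_mat (R_mat B S j))) \<le> \<gamma>R j" if "j \<in> {1..N}" for j
    using g(1) that by (auto simp: admissible_def)
  have "0 < \<gamma>E 0"
  proof -
    have "0 < Min (spectrum (E_mat A S 0))" using E0 Efin[of 0] by simp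
    then show ?thesis using gE[of 0] by simp
  qed
  moreover have "0 \<le> \<gamma>E j" if "j \<in> {1..k}" for j
  proof -
    have j: "j \<le> N" using that k by simp
    have "0 \<le> Min (spectrum (E_mat A S j))" using E[OF j] Efin[OF j] by simp
    then show ?thesis using gE[OF j] by simp
  qed
  moreover have "0 < \<gamma>R j" if "j \<in> {1..k}" for j
  proof -
    have j: "j \<in> {1..N}" using that k by simp
    have "0 < Min (spectrum (R_mat B S j * transpose_mat (R_mat B S j)))"
      using R[OF j] Rfin[OF j] by simp
    then show ?thesis using gR[OF j] by simp
  qed
  ultimately have "0 < (-1) ^ Suc k * (poly (U_poly \<gamma>E \<gamma>R (Suc k)) 0 * poly (U_poly \<gamma>E \<gamma>R k) (0 :: real))"
    by (rule U_poly_at_0)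
  then show False using g(2) by simp
qed

lemma subset_interval_hull: "X \<subseteq> interval_hull X"
  by (auto simp: interval_hull_def)

lemma root_set_subset_I_set:
  assumes "0 \<notin> root_set N A B S k"
  shows "root_set N A B S k \<subseteq> I_set N A B S k"
proof
  fix t assume t: "t \<in> root_set N A B S k"
  then have "t \<in> root_set N A B S k \<inter> {..<0} \<or> t \<in> root_set N A B S k \<inter> {0<..}"
    using assms by (cases t "0 :: real" rule: linorder_cases) auto
  then show "t \<in> I_set N A B S k"
    unfolding I_set_def
  proof (elim disjE)
    assume "t \<in> root_set N A B S k \<inter> {..<0}"
    from subsetD[OF subset_interval_hull this]
    show "t \<in> interval_hull (root_set N A B S k \<inter> {..<0}) \<union>
      interval_hull (root_set N A B S k \<inter> {0<..})" by (rule UnI1)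
  next
    assume "t \<in> root_set N A B S k \<inter> {0<..}"
    from subsetD[OF subset_interval_hull this]
    show "t \<in> interval_hull (root_set N A B S k \<inter> {..<0}) \<union>
      interval_hull (root_set N A B S k \<inter> {0<..})" by (rule UnI2)
  qed
qed

section \<open>The eigenvalue inclusion\<close>

theorem theorem1:
  fixes N :: nat and n :: "nat \<Rightarrow> nat" and A B S :: "nat \<Rightarrow> real mat" and \<mu> :: complex
  assumes "N \<ge> 1"
    and "\<forall>k\<in>{1..N}. n (k - 1) \<ge> n k"
    and "n N \<ge> 1"
    and "sym_pos_def (n 0) (A 0)"
    and "\<forall>k\<in>{1..N}. sym_pos_semidef (n k) (A k)"
    and "\<forall>k\<in>{1..N}. B k \<in> carrier_mat (n k) (n (k - 1)) \<and> full_rank (B k)"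
    and "\<forall>k\<in>{0..N}. sym_pos_def (n k) (S k)"
    and "eigenvalue (map_mat complex_of_real (mat_inv (precond_mat N S) * tridiag_mat N n A B)) \<mu>"
  shows "\<mu> \<in> complex_of_real ` (\<Union>k\<in>{0..N}. I_set N A B S (Suc k))"
proof -
  have n: "0 < n k" if "k \<le> N" for k
    using that
  proof (induction k rule: inc_induct)
    case base
    show ?case using assms(3) by simp
  next
    case (step k)
    then have "n (Suc k) \<le> n k" using bspec[OF assms(2), of "Suc k"] by simp
    then show ?case using step.IH by simp
  qed
  have A: "sym_pos_semidef (n k) (A k)" if "k \<le> N" for k
    using that assms(5) sym_pos_def_imp_semidef[OF assms(4)] by (cases "k = 0") auto
  have As: "sym_mat (n k) (A k)" if "k \<le> N" for k using A[OF that] by (simp only: sym_pos_semidef_iff)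
  have S: "sym_pos_def (n k) (S k)" if "k \<le> N" for k using assms(7) that by auto
  have B: "B k \<in> carrier_mat (n k) (n (k - 1))" "full_rank (B k)" "n k \<le> n (k - 1)" if "k \<in> {1..N}" for k
    using assms(2,6) that by auto
  have T: "inv_sqrt (S k) \<in> carrier_mat (n k) (n k)" "transpose_mat (inv_sqrt (S k)) = inv_sqrt (S k)"
    if "k \<le> N" for k
    using inv_sqrt_props(1)[OF S[OF that]] by (simp_all only: sym_mat_def)
  have E: "sym_mat (n k) (E_mat A S k)" if "k \<le> N" for k
    by (rule sym_mat_E_mat[where A = A and S = S and k = k, OF As[OF that] S[OF that]])
  have R: "R_mat B S k \<in> carrier_mat (n k) (n (k - 1))" if "k \<in> {1..N}" for k
  proof -
    have "k \<le> N" "k - 1 \<le> N" using that by auto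
    then show ?thesis
      unfolding R_mat_def using T(1)[of k] T(1)[of "k - 1"] B(1)[OF that] by (intro mult_carrier_mat)
  qed
  have Tv: "inv_sqrt (S k) *\<^sub>v v \<in> carrier_vec (n k)" if "k \<le> N" "v \<in> carrier_vec (n k)" for k v
    by (rule mult_mat_vec_carrier[OF T(1)[OF that(1)] that(2)])
  have Epsd: "sym_pos_semidef (n k) (E_mat A S k)" if k: "k \<le> N" for k
    unfolding sym_pos_semidef_iff
  proof (intro conjI ballI E k)
    fix v :: "real vec" assume v: "v \<in> carrier_vec (n k)"
    show "0 \<le> v \<bullet> (E_mat A S k *\<^sub>v v)"
      unfolding E_mat_form[where A = A and S = S and k = k, OF As[OF k] S[OF k] v]
      using A[OF k] Tv[OF k v] unfolding sym_pos_semidef_def by blast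
  qed
  have E0pd: "sym_pos_def (n 0) (E_mat A S 0)"
  proof (rule sym_pos_semidef_inj_imp_def[OF Epsd])
    fix v :: "real vec" assume v: "v \<in> carrier_vec (n 0)" "E_mat A S 0 *\<^sub>v v = 0\<^sub>v (n 0)"
    have "(inv_sqrt (S 0) *\<^sub>v v) \<bullet> (A 0 *\<^sub>v (inv_sqrt (S 0) *\<^sub>v v)) = 0"
      using E_mat_form[where A = A and S = S and k = 0, OF As[of 0] S[of 0] v(1)] v by simp
    then have "\<not> 0 < (inv_sqrt (S 0) *\<^sub>v v) \<bullet> (A 0 *\<^sub>v (inv_sqrt (S 0) *\<^sub>v v))" by simp
    then have "inv_sqrt (S 0) *\<^sub>v v = 0\<^sub>v (n 0)"
      using assms(4) Tv[OF le0 v(1)] unfolding sym_pos_def_def by blast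
    then show "v = 0\<^sub>v (n 0)" using inv_sqrt_inj[OF S[of 0] v(1)] by simp
  qed simp
  \<comment> \<open>The form is \<open>y \<bullet> y\<close> with \<open>y = R\<^sub>k\<^sup>T v\<close>, and \<open>R\<^sub>k\<^sup>T\<close> is injective because the transpose of
    \<open>B k\<close> is, by full rank.\<close>
  have Rpd: "sym_pos_def (n k) (R_mat B S k * transpose_mat (R_mat B S k))" if k: "k \<in> {1..N}" for k
    unfolding sym_pos_def_iff
  proof (intro conjI ballI impI)
    show "sym_mat (n k) (R_mat B S k * transpose_mat (R_mat B S k))"
      by (rule RR_sym[of N n A S B, OF n E R k])
    fix v :: "real vec" assume v: "v \<in> carrier_vec (n k)" "v \<noteq> 0\<^sub>v (n k)"
    define y where "y = transpose_mat (R_mat B S k) *\<^sub>v v"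
    have kN: "k \<le> N" "k - 1 \<le> N" using k by auto
    have y: "y \<in> carrier_vec (n (k - 1))" unfolding y_def using R[OF k] v(1) by (intro mult_mat_vec_carrier) auto
    have "y \<noteq> 0\<^sub>v (n (k - 1))"
    proof
      assume y0: "y = 0\<^sub>v (n (k - 1))"
      let ?T = "inv_sqrt (S k)" and ?T' = "inv_sqrt (S (k - 1))"
      have Bt: "transpose_mat (B k) \<in> carrier_mat (n (k - 1)) (n k)" using B(1)[OF k] by simp
      have "transpose_mat (R_mat B S k) = transpose_mat ?T' * transpose_mat (?T * B k)"
        unfolding R_mat_def by (rule transpose_mult[OF mult_carrier_mat[OF T(1)[OF kN(1)] B(1)[OF k]] T(1)[OF kN(2)]])
      also have "transpose_mat (?T * B k) = transpose_mat (B k) * transpose_mat ?T"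
        by (rule transpose_mult[OF T(1)[OF kN(1)] B(1)[OF k]])
      also have "transpose_mat ?T' * (transpose_mat (B k) * transpose_mat ?T) = ?T' * transpose_mat (B k) * ?T"
        unfolding T(2)[OF kN(1)] T(2)[OF kN(2)]
        by (rule assoc_mult_mat[symmetric, OF T(1)[OF kN(2)] Bt T(1)[OF kN(1)]])
      finally have "y = ?T' *\<^sub>v (transpose_mat (B k) *\<^sub>v (?T *\<^sub>v v))"
        unfolding y_def using mult3_mat_vec[OF T(1)[OF kN(2)] Bt T(1)[OF kN(1)] v(1)] by simp
      then have "transpose_mat (B k) *\<^sub>v (?T *\<^sub>v v) = 0\<^sub>v (n (k - 1))"
        using inv_sqrt_inj[OF S[OF kN(2)] mult_mat_vec_carrier[OF Bt Tv[OF kN(1) v(1)]]] y0 by simp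
      then have "?T *\<^sub>v v = 0\<^sub>v (n k)"
        by (rule full_rank_transpose_inj[OF B(1,3,2)[OF k] Tv[OF kN(1) v(1)]])
      then show False using inv_sqrt_inj[OF S[OF kN(1)] v(1)] v(2) by simp
    qed
    then have "0 < y \<bullet> y" by (rule real_scalar_prod_self_pos[OF y])
    moreover have "v \<bullet> (R_mat B S k * transpose_mat (R_mat B S k) *\<^sub>v v) = y \<bullet> y"
      unfolding y_def by (rule RR_form[of N n A S B, OF n E R k v(1)])
    ultimately show "0 < v \<bullet> (R_mat B S k * transpose_mat (R_mat B S k) *\<^sub>v v)" by (simp only:)
  qed
  have no_zero: "0 \<notin> root_set N A B S (Suc k)" if "k \<le> N" for k
  proof (rule zero_notin_root_set[OF _ _ _ _ _ that])
    show "0 < e" if "e \<in> spectrum (E_mat A S 0)" for e by (rule spectrum_pos[OF E0pd that])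
    show "0 \<le> e" if "j \<le> N" "e \<in> spectrum (E_mat A S j)" for j e
      by (rule spectrum_nonneg[OF Epsd[OF that(1)] that(2)])
    show "0 < e" if "j \<in> {1..N}" "e \<in> spectrum (R_mat B S j * transpose_mat (R_mat B S j))" for j e
      by (rule spectrum_pos[OF Rpd[OF that(1)] that(2)])
    show "finite (spectrum (E_mat A S j)) \<and> spectrum (E_mat A S j) \<noteq> {}" if "j \<le> N" for j
      using spectrum_sym_bounds(1,2)[OF E[OF that] n[OF that]] by blast
    show "finite (spectrum (R_mat B S j * transpose_mat (R_mat B S j))) \<and>
      spectrum (R_mat B S j * transpose_mat (R_mat B S j)) \<noteq> {}" if "j \<in> {1..N}" for j
    proof -
      have "sym_mat (n j) (R_mat B S j * transpose_mat (R_mat B S j))" "0 < n j"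
        using Rpd[OF that] n[of j] that by (simp_all only: sym_pos_def_iff atLeastAtMost_iff)
      then show ?thesis using spectrum_sym_bounds(1,2) by blast
    qed
  qed
  obtain t x where t: "\<mu> = complex_of_real t"
    and x: "\<And>k. k \<le> N \<Longrightarrow> x k \<in> carrier_vec (n k)" "\<exists>k\<le>N. x k \<noteq> 0\<^sub>v (n k)"
    and rec: "\<And>k. k \<le> N \<Longrightarrow> t \<cdot>\<^sub>v x k =
      (-1) ^ k \<cdot>\<^sub>v (E_mat A S k *\<^sub>v x k)
      + (if 0 < k then R_mat B S k *\<^sub>v x (k - 1) else 0\<^sub>v (n k))
      + (if k < N then transpose_mat (R_mat B S (Suc k)) *\<^sub>v x (Suc k) else 0\<^sub>v (n k))"
    using block_recurrence_exists[where N = N and n = n and A = A and B = B and S = S, OF As B(1) S assms(8)]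
    by blast
  obtain k where k: "k \<le> N" "t \<in> root_set N A B S (Suc k)"
    using eigenvalue_is_root[of N n A S B, OF n E R x(1) rec x(2)] by auto
  have "t \<in> I_set N A B S (Suc k)"
    by (rule subsetD[OF root_set_subset_I_set[OF no_zero[OF k(1)]] k(2)])
  then have "t \<in> (\<Union>k\<in>{0..N}. I_set N A B S (Suc k))"
    using k(1) by (intro UN_I[of k]) simp_all
  then show ?thesis unfolding t by (rule imageI)
qed

end
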